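(* Let $n\ge 3$, $0<\theta\le\pi$, $0\le\phi\le\pi$, and let $d\ge 0$ be an integer. Define $$\Delta=\{(u,v,t)\in\mathbb{R}^3 : \cos\phi\le u\le v\le 1,\ -1\le t\le\cos\theta,\ 1+2uvt-u^2-v^2-t^2\ge 0\},$$ $$\Delta_0=\{(u,u,1) : \cos\phi\le u\le 1\}.$$ Let $M\in\mathbb{R}$ and, for $k=0,\dots,d$, let $F_k$ be a real symmetric $(d-k+1)\times(d-k+1)$ matrix such that (i) $F_k\succeq 0$ for all $k=0,\dots,d$; (ii) $\sum_{k=0}^d\langle F_k,\overline{Y}_k^n(u,u,1)\rangle\le M$ for all $(u,u,1)\in\Delta_0$; (iii) $\sum_{k=0}^d\langle F_k,\overline{Y}_k^n(u,v,t)\rangle\le -1$ for all $(u,v,t)\in\Delta$. Then $A(n,\theta,\phi)\le 1+M$.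
   Context: $S^{n-1}=\{x\in\mathbb{R}^n: x\cdot x=1\}$, and $e\in S^{n-1}$ is a fixed point. The spherical cap with center $e$ and angular radius $\phi$ is $\operatorname{Cap}(e,\phi)=\{x\in S^{n-1}: e\cdot x\ge\cos\phi\}$. $A(n,\theta,\phi)$ is the maximal cardinality of a finite set (code) $C\subset\operatorname{Cap}(e,\phi)$ with minimal angular distance at least $\theta$, i.e. $c\cdot c'\le\cos\theta$ for all distinct $c,c'\in C$. Notation: $\langle A,B\rangle=\operatorname{Trace}(AB^t)$; $A\succeq 0$ means that the symmetric matrix $A$ is positive semidefinite. $\omega_m$ is the surface area of $S^{m-1}\subset\mathbb{R}^m$ (so $\omega_1=2$). $h_k^m$ is the dimension of the space of homogeneous harmonic real polynomials of degree $k$ in $m$ variables. For $m\ge 3$, $P_k^m(t)$ is the Gegenbauer polynomial of degree $k$ with parameter $m/2-1$, normalized by $P_k^m(1)=1$; for $m=2$, $P_k^2(t)$ is the Chebyshev polynomial of the first kind of degree $k$. For $0\le k\le d$, $Y_k^n(u,v,t)$ is the $(d-k+1)\times(d-k+1)$ matrix with entries indexed by $0\le i,j\le d-k$, $$(Y_k^n)_{i,j}(u,v,t)=\lambda_{i,j}\,P_i^{n+2k}(u)\,P_j^{n+2k}(v)\,Q_k^{n-1}(u,v,t),$$ where $$Q_k^{n-1}(u,v,t)=\big((1-u^2)(1-v^2)\big)^{k/2}P_k^{n-1}\Big(\tfrac{t-uv}{\sqrt{(1-u^2)(1-v^2)}}\Big)$$ (a polynomial in $u,v,t$, and understood as such everywhere),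 and $$\lambda_{i,j}=\frac{\omega_n}{\omega_{n-1}}\frac{\omega_{n+2k-1}}{\omega_{n+2k}}\,(h_i^{n+2k}h_j^{n+2k})^{1/2}.$$ Finally $\overline{Y}_k^n(u,v,t)=\tfrac12\big(Y_k^n(u,v,t)+Y_k^n(v,u,t)\big)$. *)

theory Defs
  imports
    "HOL-Analysis.Analysis"
    "HOL-Library.Poly_Mapping"
    "HOL-Computational_Algebra.Polynomial"
    "Jordan_Normal_Form.Matrix"
begin

(* Jordan_Normal_Form claims the same symbol as the inner product of HOL-Analysis. *)
no_notation scalar_prod (infix "\<bullet>" 70)
hide_const (open) module.smult

section \<open>Spherical codes in a cap\<close>

definition cap :: "real^'n \<Rightarrow> real \<Rightarrow> (real^'n) set" where
  "cap e \<phi> = {x \<in> sphere 0 1. e \<bullet> x \<ge> cos \<phi>}"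

definition cap_code :: "real^'n \<Rightarrow> real \<Rightarrow> real \<Rightarrow> (real^'n) set \<Rightarrow> bool" where
  "cap_code e \<theta> \<phi> C \<longleftrightarrow>
     finite C \<and> C \<subseteq> cap e \<phi> \<and> (\<forall>c\<in>C. \<forall>c'\<in>C. c \<noteq> c' \<longrightarrow> c \<bullet> c' \<le> cos \<theta>)"

(* The dimension n is CARD('n). The centre e is kept as an argument; by rotation
   invariance the value is the same for every unit vector e. *)
definition max_code :: "real^'n \<Rightarrow> real \<Rightarrow> real \<Rightarrow> nat" where
  "max_code e \<theta> \<phi> = Max {card C | C. cap_code e \<theta> \<phi> C}"

(* Max is only meaningful on finite nonempty sets; this is the case for all the angles
   under consideration. *)
lemma finite_code_cards:
  fixes e :: "real^'n"
  assumes "0 < \<theta>" "\<theta> \<le> pi"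
  shows "finite {card C | C. cap_code e \<theta> \<phi> C}" "{card C | C. cap_code e \<theta> \<phi> C} \<noteq> {}"
proof -
  define r where "r = sqrt (2 - 2 * cos \<theta>) / 2"
  have "cos \<theta> < cos 0"
    using assms by (intro cos_monotone_0_pi) auto
  then have r: "r > 0" by (simp add: r_def)
  obtain K where K: "finite K" "sphere 0 1 \<subseteq> (\<Union>x\<in>K. ball (x::real^'n) r)"
    using compactE_image[of "sphere (0::real^'n) 1" UNIV "\<lambda>x. ball x r"] r
    by (metis UN_I UNIV_I centre_in_ball compact_sphere open_ball subsetI)
  have "card C \<le> card K" if "cap_code e \<theta> \<phi> C" for C
  proof -
    have "\<forall>c\<in>C. \<exists>x\<in>K. c \<in> ball x r"
      using that K(2) unfolding cap_code_def cap_def by blast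
    then obtain g where g: "\<And>c. c \<in> C \<Longrightarrow> g c \<in> K \<and> c \<in> ball (g c) r" by metis
    have "inj_on g C"
    proof (rule inj_onI, rule ccontr)
      fix c c' assume c: "c \<in> C" "c' \<in> C" "g c = g c'" "c \<noteq> c'"
      have "dist c c' < 2 * r"
        using g[OF c(1)] g[OF c(2)] c(3) dist_triangle2[of c c' "g c"]
        by (simp add: dist_commute)
      then have "norm (c - c') < sqrt (2 - 2 * cos \<theta>)" by (simp add: r_def dist_norm)
      then have "(norm (c - c'))\<^sup>2 < 2 - 2 * cos \<theta>"
        by (metis norm_ge_zero not_less real_le_lsqrt real_sqrt_abs abs_norm_cancel
              real_sqrt_le_iff)
      moreover have "norm c = 1" "norm c' = 1" "c \<bullet> c' \<le> cos \<theta>"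
        using that c unfolding cap_code_def cap_def by auto
      then have "c \<bullet> c = 1" "c' \<bullet> c' = 1" "c \<bullet> c' \<le> cos \<theta>"
        by (simp_all add: dot_square_norm)
      then have "(norm (c - c'))\<^sup>2 \<ge> 2 - 2 * cos \<theta>"
        by (simp add: power2_norm_eq_inner inner_diff inner_commute)
      ultimately show False by simp
    qed
    then show ?thesis using g K(1) by (meson card_inj_on_le image_subsetI)
  qed
  then have "{card C | C. cap_code e \<theta> \<phi> C} \<subseteq> {..card K}" by auto
  then show "finite {card C | C. cap_code e \<theta> \<phi> C}" by (rule finite_subset) simp
  have "cap_code e \<theta> \<phi> {}" by (simp add: cap_code_def)
  then show "{card C | C. cap_code e \<theta> \<phi> C} \<noteq> {}" by blast
qed


section \<open>Surface area of the unit sphere\<close>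

(* omega m is the area of the unit sphere in R^m, i.e. 2 pi^(m/2) / Gamma(m/2). The library
   has no surface measure; the area is expressed as m times the volume of the unit ball,
   which is the rate of growth of the volume of a ball at radius 1. *)
definition omega :: "nat \<Rightarrow> real" where
  "omega m = real m * unit_ball_vol (real m)"

lemma omega_1: "omega 1 = 2"
  by (simp add: omega_def)

lemma omega_altdef:
  assumes "m \<ge> 1"
  shows "omega m = 2 * pi powr (real m / 2) / Gamma (real m / 2)"
proof -
  have eq: "Gamma (real m / 2 + 1) = real m / 2 * Gamma (real m / 2)"
    using assms by (intro Gamma_plus1) auto
  show ?thesis using assms unfolding omega_def unit_ball_vol_def eq by simp
qed

lemma omega_derivative_ball_volume:
  "((\<lambda>r. measure lborel (ball (0::'a::euclidean_space) r))
      has_real_derivative omega DIM('a)) (at 1)"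
proof (rule DERIV_cong_ev[THEN iffD2])
  show "\<forall>\<^sub>F r in nhds 1. measure lborel (ball (0::'a) r)
          = unit_ball_vol (real DIM('a)) * r ^ DIM('a)"
    using eventually_nhds_in_open[of "{0<..}" "1::real"]
    by (auto elim!: eventually_mono simp: content_ball)
  show "((\<lambda>r. unit_ball_vol (real DIM('a)) * r ^ DIM('a))
          has_real_derivative omega DIM('a)) (at 1)"
    by (auto intro!: derivative_eq_intros simp: omega_def)
qed auto


section \<open>Homogeneous harmonic polynomials\<close>

(* Real polynomials in variables indexed by natural numbers: an exponent vector is a
   finitely supported map from variables to nat, a polynomial is a finitely supported map
   from exponent vectors to coefficients. *)
type_synonym rpoly = "(nat \<Rightarrow>\<^sub>0 nat) \<Rightarrow>\<^sub>0 real"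

definition rpoly_scale :: "real \<Rightarrow> rpoly \<Rightarrow> rpoly" where
  "rpoly_scale c p = Poly_Mapping.map (\<lambda>a. c * a) p"

lemma vector_space_rpoly_scale: "vector_space rpoly_scale"
  by unfold_locales
     (auto intro!: poly_mapping_eqI
           simp: rpoly_scale_def Poly_Mapping.map.rep_eq lookup_add when_def distrib_left[symmetric] distrib_right[symmetric]
             mult.assoc)

(* For a monomial not involving variable i the truncated subtraction is harmless,
   since its coefficient becomes 0. *)
definition partial_deriv :: "nat \<Rightarrow> rpoly \<Rightarrow> rpoly" where
  "partial_deriv i p = (\<Sum>\<alpha>\<in>Poly_Mapping.keys p.
     Poly_Mapping.single (\<alpha> - Poly_Mapping.single i 1)
       (real (Poly_Mapping.lookup \<alpha> i) * Poly_Mapping.lookup p \<alpha>))"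

definition laplacian :: "nat \<Rightarrow> rpoly \<Rightarrow> rpoly" where
  "laplacian m p = (\<Sum>i<m. partial_deriv i (partial_deriv i p))"

definition homogeneous :: "nat \<Rightarrow> nat \<Rightarrow> rpoly \<Rightarrow> bool" where
  "homogeneous m k p \<longleftrightarrow> (\<forall>\<alpha>\<in>Poly_Mapping.keys p.
     Poly_Mapping.keys \<alpha> \<subseteq> {..<m} \<and> (\<Sum>i<m. Poly_Mapping.lookup \<alpha> i) = k)"

definition harmonic_space :: "nat \<Rightarrow> nat \<Rightarrow> rpoly set" where
  "harmonic_space m k = {p. homogeneous m k p \<and> laplacian m p = 0}"

definition harmonic_dim :: "nat \<Rightarrow> nat \<Rightarrow> nat" where
  "harmonic_dim m k = vector_space.dim rpoly_scale (harmonic_space m k)"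


section \<open>Gegenbauer and Chebyshev polynomials\<close>

fun gegenbauer :: "real \<Rightarrow> nat \<Rightarrow> real poly" where
  "gegenbauer \<mu> 0 = 1"
| "gegenbauer \<mu> (Suc 0) = [:0, 2 * \<mu>:]"
| "gegenbauer \<mu> (Suc (Suc k)) = smult (1 / real (k + 2))
     (smult (2 * (real k + 1 + \<mu>)) ([:0, 1:] * gegenbauer \<mu> (Suc k))
      - smult (real k + 2 * \<mu>) (gegenbauer \<mu> k))"

fun chebyshev :: "nat \<Rightarrow> real poly" where
  "chebyshev 0 = 1"
| "chebyshev (Suc 0) = [:0, 1:]"
| "chebyshev (Suc (Suc k)) = [:0, 2:] * chebyshev (Suc k) - chebyshev k"

(* zonal m k is P_k^m, for m \<ge> 2. *)
definition zonal :: "nat \<Rightarrow> nat \<Rightarrow> real poly" where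
  "zonal m k = (if m = 2 then chebyshev k
     else smult (1 / poly (gegenbauer (real m / 2 - 1) k) 1) (gegenbauer (real m / 2 - 1) k))"

lemma poly_gegenbauer_1: "poly (gegenbauer \<mu> k) 1 = pochhammer (2 * \<mu>) k / fact k"
proof (induction \<mu> k rule: gegenbauer.induct)
  case (3 \<mu> k)
  have "pochhammer (2 * \<mu>) (Suc k) = pochhammer (2 * \<mu>) k * (2 * \<mu> + real k)"
       "pochhammer (2 * \<mu>) (Suc (Suc k))
          = pochhammer (2 * \<mu>) k * (2 * \<mu> + real k) * (2 * \<mu> + real k + 1)"
    by (simp_all add: pochhammer_Suc algebra_simps)
  moreover have "fact (Suc k) = (real k + 1) * fact k"
       "fact (Suc (Suc k)) = (real k + 2) * (real k + 1) * (fact k :: real)"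
    by (simp_all add: algebra_simps)
  moreover define a f where "a = pochhammer (2 * \<mu>) k" and "f = (fact k :: real)"
  moreover have "f > 0" by (simp add: f_def)
  moreover have "1 / (k' + 2) * (2 * (k' + 1 + \<mu>) * (a * (2 * \<mu> + k') / ((k' + 1) * f))
                   - (k' + 2 * \<mu>) * (a / f))
      = a * (2 * \<mu> + k') * (2 * \<mu> + k' + 1) / ((k' + 2) * (k' + 1) * f)"
    if "k' = real k" "f > 0" for k' :: real
    using that by (simp add: divide_simps) (simp add: algebra_simps)
  ultimately show ?case using 3
    by (simp add: add.commute del: fact_Suc)
qed auto

lemma zonal_at_1:
  assumes "m \<ge> 2"
  shows "poly (zonal m k) 1 = 1"
proof (cases "m = 2")
  case True
  have "poly (chebyshev k) 1 = 1" by (induction k rule: chebyshev.induct) auto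
  with True show ?thesis by (simp add: zonal_def)
next
  case False
  with assms have "pochhammer (2 * (real m / 2 - 1)) k > 0"
    by (intro pochhammer_pos) auto
  with False show ?thesis by (simp add: zonal_def poly_gegenbauer_1)
qed

lemma poly_chebyshev_cos: "poly (chebyshev k) (cos x) = cos (real k * x)"
proof (induction k rule: chebyshev.induct)
  case (3 k)
  have "cos (real (Suc (Suc k)) * x) + cos (real k * x) = 2 * cos x * cos (real (Suc k) * x)"
    using cos_add[of "real (Suc k) * x" x] cos_diff[of "real (Suc k) * x" x]
    by (simp add: algebra_simps)
  with 3 show ?case by simp
qed auto


section \<open>The matrix-valued polynomials\<close>

(* zonal m k has degree k and the parity of k, so the half-integral powers of
   w = (1-u^2)(1-v^2) in w^(k/2) P_k^m((t-uv)/sqrt w) combine to integral ones, which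
   gives a polynomial in u, v, t that is meaningful also where w \<le> 0. *)
definition Qpoly :: "nat \<Rightarrow> nat \<Rightarrow> real \<Rightarrow> real \<Rightarrow> real \<Rightarrow> real" where
  "Qpoly m k u v t = (\<Sum>j\<le>k. coeff (zonal m k) j * (t - u * v) ^ j
     * ((1 - u\<^sup>2) * (1 - v\<^sup>2)) ^ ((k - j) div 2))"

lemma coeff_gegenbauer_nonzero: "coeff (gegenbauer \<mu> k) j \<noteq> 0 \<Longrightarrow> j \<le> k \<and> even (k - j)"
proof (induction \<mu> k arbitrary: j rule: gegenbauer.induct)
  case (2 \<mu>)
  then show ?case by (cases j) (auto simp: coeff_pCons split: nat.splits)
next
  case (3 \<mu> k)
  have "(j \<ge> 1 \<and> coeff (gegenbauer \<mu> (Suc k)) (j - 1) \<noteq> 0) \<or> coeff (gegenbauer \<mu> k) j \<noteq> 0"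
    using 3(3) by (cases j) (auto simp: coeff_pCons)
  then show ?case
    using 3(1)[of "j - 1"] 3(2)[of j] by (auto simp: Suc_diff_le)
qed (auto simp: coeff_pCons split: nat.splits)

lemma coeff_chebyshev_nonzero: "coeff (chebyshev k) j \<noteq> 0 \<Longrightarrow> j \<le> k \<and> even (k - j)"
proof (induction k arbitrary: j rule: chebyshev.induct)
  case 2
  then show ?case by (cases j) (auto simp: coeff_pCons split: nat.splits)
next
  case (3 k)
  have "(j \<ge> 1 \<and> coeff (chebyshev (Suc k)) (j - 1) \<noteq> 0) \<or> coeff (chebyshev k) j \<noteq> 0"
    using 3(3) by (cases j) (auto simp: coeff_pCons)
  then show ?case
    using 3(1)[of "j - 1"] 3(2)[of j] by (auto simp: Suc_diff_le)
qed (auto simp: coeff_pCons split: nat.splits)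

lemma coeff_zonal_nonzero: "coeff (zonal m k) j \<noteq> 0 \<Longrightarrow> j \<le> k \<and> even (k - j)"
  by (auto simp: zonal_def split: if_splits
           dest: coeff_gegenbauer_nonzero coeff_chebyshev_nonzero)

lemma Qpoly_eq:
  fixes u v t :: real
  defines "w \<equiv> (1 - u\<^sup>2) * (1 - v\<^sup>2)"
  assumes "w > 0"
  shows "Qpoly m k u v t = w powr (real k / 2) * poly (zonal m k) ((t - u * v) / sqrt w)"
proof -
  have "degree (zonal m k) \<le> k"
    using coeff_zonal_nonzero by (metis degree_le not_le)
  then have "poly (zonal m k) x = (\<Sum>j\<le>k. coeff (zonal m k) j * x ^ j)" for x
    unfolding poly_altdef by (intro sum.mono_neutral_left) (auto simp: coeff_eq_0)
  moreover have "w powr (real k / 2) = sqrt w ^ k"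
    using assms(2) by (simp add: powr_half_sqrt[symmetric] powr_power mult.commute)
  moreover have "coeff (zonal m k) j * (t - u * v) ^ j * w ^ ((k - j) div 2)
      = sqrt w ^ k * (coeff (zonal m k) j * ((t - u * v) / sqrt w) ^ j)" for j
  proof (cases "coeff (zonal m k) j = 0")
    case False
    then have "j \<le> k" "even (k - j)" using coeff_zonal_nonzero by blast+
    then obtain l where l: "k = j + 2 * l" by (metis evenE le_add_diff_inverse)
    have "sqrt w ^ (2 * l) = w ^ l" using assms(2) by (simp add: power_mult)
    then show ?thesis using assms(2) by (simp add: l power_add power_divide)
  qed simp
  ultimately show ?thesis
    by (simp only: Qpoly_def w_def[symmetric] sum_distrib_left)
qed

definition lam :: "nat \<Rightarrow> nat \<Rightarrow> nat \<Rightarrow> nat \<Rightarrow> real" where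
  "lam n k i j = omega n / omega (n - 1) * (omega (n + 2 * k - 1) / omega (n + 2 * k))
     * sqrt (real (harmonic_dim (n + 2 * k) i) * real (harmonic_dim (n + 2 * k) j))"

definition Ymat :: "nat \<Rightarrow> nat \<Rightarrow> nat \<Rightarrow> real \<Rightarrow> real \<Rightarrow> real \<Rightarrow> real mat" where
  "Ymat n d k u v t = mat (d - k + 1) (d - k + 1) (\<lambda>(i, j).
     lam n k i j * poly (zonal (n + 2 * k) i) u * poly (zonal (n + 2 * k) j) v
       * Qpoly (n - 1) k u v t)"

definition Ybar :: "nat \<Rightarrow> nat \<Rightarrow> nat \<Rightarrow> real \<Rightarrow> real \<Rightarrow> real \<Rightarrow> real mat" where
  "Ybar n d k u v t = (1 / 2) \<cdot>\<^sub>m (Ymat n d k u v t + Ymat n d k v u t)"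


section \<open>Matrix notions and the constraint domains\<close>

definition mat_trace :: "real mat \<Rightarrow> real" where
  "mat_trace A = (\<Sum>i<dim_row A. A $$ (i, i))"

definition mat_inner :: "real mat \<Rightarrow> real mat \<Rightarrow> real" where
  "mat_inner A B = mat_trace (A * transpose_mat B)"

definition symmetric_matrix :: "real mat \<Rightarrow> bool" where
  "symmetric_matrix A \<longleftrightarrow> square_mat A \<and> transpose_mat A = A"

definition pos_semidef :: "real mat \<Rightarrow> bool" where
  "pos_semidef A \<longleftrightarrow> symmetric_matrix A \<and>
     (\<forall>x\<in>carrier_vec (dim_row A). 0 \<le> scalar_prod x (A *\<^sub>v x))"

definition Delta :: "real \<Rightarrow> real \<Rightarrow> (real \<times> real \<times> real) set" where
  "Delta \<theta> \<phi> = {(u, v, t). cos \<phi> \<le> u \<and> u \<le> v \<and> v \<le> 1 \<and> -1 \<le> t \<and> t \<le> cos \<theta> \<and>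
     1 + 2 * u * v * t - u\<^sup>2 - v\<^sup>2 - t\<^sup>2 \<ge> 0}"

definition Delta0 :: "real \<Rightarrow> (real \<times> real \<times> real) set" where
  "Delta0 \<phi> = {(u, u, 1) | u. cos \<phi> \<le> u \<and> u \<le> 1}"

end

theory Submission
  imports Defs
begin

text \<open>
  Sum the matrices \<open>Y\<^sub>k(e \<bullet> c, e \<bullet> c', c \<bullet> c')\<close> over all ordered pairs of points of a code \<open>C\<close>. If their
  pairing with every positive semidefinite \<open>F\<^sub>k\<close> is nonnegative, then summing over \<open>k\<close> and
  bounding the \<open>card C\<close> diagonal pairs by \<open>M\<close> and the \<open>card C * (card C - 1)\<close> remaining
  ones by \<open>-1\<close> gives \<open>0 \<le> card C * (M - (card C - 1))\<close>, hence the claim.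

  The positivity has two ingredients. The entries of \<open>Y\<^sub>k\<close> are a nonnegative constant times
  \<open>z\<^sub>i(c) z\<^sub>j(c') Q\<^sub>k\<close>, where \<open>z\<^sub>i(c)\<close> depends on \<open>e \<bullet> c\<close> only, so the pairing with \<open>F\<^sub>k\<close> is the
  product of the positive semidefinite kernel \<open>z(c)\<^sup>T F\<^sub>k z(c')\<close> with \<open>Q\<^sub>k\<close>. And \<open>Q\<^sub>k\<close> is itself a
  positive semidefinite kernel: if \<open>x, y\<close> are the projections of \<open>c, c'\<close> to the orthogonal
  complement of \<open>e\<close>, a space of dimension \<open>m = n - 1\<close>, then \<open>Q\<^sub>k\<close> is
  \<open>(\<bar>x\<bar> \<bar>y\<bar>)\<^sup>k P\<^sub>k\<^sup>m(cos \<angle>(x,y))\<close>, the zonal kernel of degree \<open>k\<close> on that space.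

  That the zonal kernel \<open>K(x,y)\<close> is positive semidefinite is shown algebraically, with no
  integration over spheres. For fixed \<open>y\<close> it is a polynomial \<open>f\<^sub>y\<close> in \<open>x\<close>, homogeneous of
  degree \<open>k\<close>, and the Gegenbauer differential equation says that \<open>f\<^sub>y\<close> is harmonic. Take the
  Fischer inner product on homogeneous polynomials of degree \<open>k\<close>, for which multiplication by
  a variable is, up to a factor, adjoint to the partial derivative. Then multiples of \<open>\<bar>x\<bar>\<^sup>2\<close> are
  orthogonal to harmonic polynomials, and pairing with \<open>(x \<bullet> z)\<^sup>k\<close> is, up to a factor,
  evaluation at \<open>z\<close>. Since \<open>f\<^sub>z\<close> is \<open>a (x \<bullet> z)\<^sup>k\<close> plus a multiple of \<open>\<bar>x\<bar>\<^sup>2\<close>, with \<open>a > 0\<close> the leading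
  coefficient of \<open>P\<^sub>k\<^sup>m\<close>, this shows that \<open>K(z,y)\<close> is a positive multiple of the Fischer product
  of \<open>f\<^sub>z\<close> and \<open>f\<^sub>y\<close> (lemma \<open>fischer_zonal_harmonic\<close>): the zonal kernel is a Gram matrix.
  The product of the two kernels is then handled by \<open>sum_fischer_nonneg\<close>.
\<close>

\<comment> \<open>The dollar sign is needed for the components of \<open>real^'n\<close>.\<close>
no_notation vec_index (infixl "$" 100)

section \<open>The differential equation of the zonal polynomials\<close>

lemma zonal_0: "zonal m 0 = 1"
  by (simp add: zonal_def)

lemma zonal_1:
  assumes "m \<ge> 2"
  shows "zonal m (Suc 0) = [:0, 1:]"
  using assms by (auto simp: zonal_def)

text \<open>
  Normalizing the Gegenbauer recurrence to value 1 at 1 makes its coefficients depend on the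
  dimension in a way that also covers the Chebyshev case \<open>m = 2\<close>, so that from here on the two
  families need not be distinguished.
\<close>

lemma zonal_recurrence:
  assumes m: "m \<ge> 2"
  shows "of_nat (k + m - 1) * zonal m (Suc (Suc k)) =
    of_nat (2 * k + m) * ([:0, 1:] * zonal m (Suc k)) - of_nat (Suc k) * zonal m k"
proof (cases "m = 2")
  case True
  define X :: "real poly" where "X = [:0, 1:]"
  have "[:0, 2::real:] = 2 * X" by (simp add: numeral_poly X_def)
  then have eq: "zonal m (Suc (Suc k)) = 2 * (X * zonal m (Suc k)) - zonal m k"
    using True by (simp add: zonal_def mult.assoc)
  show ?thesis unfolding X_def[symmetric] eq by (simp add: True algebra_simps)
next
  case False
  define \<mu> where "\<mu> = real m / 2 - 1"
  define \<gamma> where "\<gamma> = (\<lambda>k. poly (gegenbauer \<mu> k) 1)"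
  have \<mu>: "\<mu> > 0" using m False by (simp add: \<mu>_def)
  have pos: "\<gamma> k > 0" for k
    unfolding \<gamma>_def poly_gegenbauer_1 using \<mu> by (intro divide_pos_pos pochhammer_pos) auto
  have step: "(real k + 1) * \<gamma> (Suc k) = (real k + 2 * \<mu>) * \<gamma> k" for k
  proof -
    have "fact (Suc k) = (real k + 1) * fact k" by (simp add: algebra_simps)
    moreover have "x * (p * s / (x * f)) = s * (p / f)" if "x \<noteq> 0" for x p s f :: real
      using that by simp
    moreover have "real k + 1 \<noteq> 0" by linarith
    ultimately show ?thesis
      unfolding \<gamma>_def poly_gegenbauer_1 pochhammer_Suc by (simp only: add.commute[of "real k" "2 * \<mu>"])
  qed
  have z: "zonal m k = smult (1 / \<gamma> k) (gegenbauer \<mu> k)" for k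
    using False by (simp add: zonal_def \<mu>_def \<gamma>_def)
  then have g: "gegenbauer \<mu> k = smult (\<gamma> k) (zonal m k)" for k
    using pos[of k] by simp
  have ofn: "of_nat j * p = smult (real j) p" for j and p :: "real poly"
    by (simp add: of_nat_poly)
  have "smult (real k + 2) (gegenbauer \<mu> (Suc (Suc k)))
      = smult (2 * (real k + 1 + \<mu>)) ([:0, 1:] * gegenbauer \<mu> (Suc k))
      - smult (real k + 2 * \<mu>) (gegenbauer \<mu> k)"
    by (simp add: add.commute)
  then have "smult ((real k + 2) * \<gamma> (Suc (Suc k))) (zonal m (Suc (Suc k)))
      = smult (2 * (real k + 1 + \<mu>) * \<gamma> (Suc k)) ([:0, 1:] * zonal m (Suc k))
      - smult ((real k + 1) * \<gamma> (Suc k)) (zonal m k)"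
    unfolding g mult_smult_right smult_smult step[of k] .
  moreover have "(real k + 2) * \<gamma> (Suc (Suc k)) = (2 * \<mu> + real k + 1) * \<gamma> (Suc k)"
    using step[of "Suc k"] by (simp add: algebra_simps)
  ultimately have "smult (\<gamma> (Suc k)) (smult (2 * \<mu> + real k + 1) (zonal m (Suc (Suc k))))
     = smult (\<gamma> (Suc k)) (smult (2 * (real k + 1 + \<mu>)) ([:0, 1:] * zonal m (Suc k))
          - smult (real k + 1) (zonal m k))"
    by (simp add: smult_diff_right mult_ac)
  then have "smult (2 * \<mu> + real k + 1) (zonal m (Suc (Suc k)))
     = smult (2 * (real k + 1 + \<mu>)) ([:0, 1:] * zonal m (Suc k))
          - smult (real k + 1) (zonal m k)"
    using pos[of "Suc k"] by (simp only: smult_eq_iff[of "\<gamma> (Suc k)"] less_irrefl) (simp add: smult_eq_iff)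
  moreover have "2 * \<mu> + real k + 1 = real (k + m - 1)"
    using m by (simp add: \<mu>_def of_nat_diff)
  moreover have "2 * (real k + 1 + \<mu>) = real (2 * k + m)" "real k + 1 = real (Suc k)"
    by (simp_all add: \<mu>_def)
  ultimately show ?thesis by (simp only: ofn)
qed

lemma pderiv_of_nat_mult: "pderiv (of_nat j * p) = of_nat j * pderiv (p :: real poly)"
  by (simp add: pderiv_mult)

text \<open>
  The two identities express the derivative through a neighbour of higher and of lower degree.
  For the same polynomial they are equivalent by the three-term recurrence, and differentiating
  the recurrence passes from one degree to the next; this is why they are proved together.
\<close>

lemma zonal_pderiv_pair:
  assumes m: "m \<ge> 2"
  shows "(1 - [:0, 1:]\<^sup>2) * pderiv (zonal m k)
           = of_nat (k + m - 2) * ([:0, 1:] * zonal m k - zonal m (Suc k))"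
    and "(1 - [:0, 1:]\<^sup>2) * pderiv (zonal m (Suc k))
           = of_nat (Suc k) * (zonal m k - [:0, 1:] * zonal m (Suc k))"
proof (induction k)
  case 0
  show "(1 - [:0, 1:]\<^sup>2) * pderiv (zonal m 0)
           = of_nat (0 + m - 2) * ([:0, 1:] * zonal m 0 - zonal m (Suc 0))"
    "(1 - [:0, 1:]\<^sup>2) * pderiv (zonal m (Suc 0))
           = of_nat (Suc 0) * (zonal m 0 - [:0, 1:] * zonal m (Suc 0))"
    using m by (simp_all add: zonal_0 zonal_1 pderiv_pCons power2_eq_square)
next
  case (Suc k)
  define X :: "real poly" where "X = [:0, 1:]"
  define K :: "real poly" where "K = of_nat k"
  define N :: "real poly" where "N = of_nat (k + m - 2)"
  define p q r where "p = zonal m k" and "q = zonal m (Suc k)" and "r = zonal m (Suc (Suc k))"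
  obtain n where n: "m = n + 2" using m by (metis add.commute le_Suc_ex)
  have rec: "(N + 1) * r = (K + N + 2) * (X * q) - (K + 1) * p"
    using zonal_recurrence[OF m, of k]
    by (simp add: n X_def K_def N_def p_def q_def r_def algebra_simps)
  have A: "(1 - X\<^sup>2) * pderiv p = N * (X * p - q)" and B: "(1 - X\<^sup>2) * pderiv q = (K + 1) * (p - X * q)"
    using Suc by (simp_all add: n X_def K_def N_def p_def q_def algebra_simps)
  have drec: "(N + 1) * pderiv r = (K + N + 2) * (q + X * pderiv q) - (K + 1) * pderiv p"
  proof -
    note const = pderiv_of_nat_mult
    have "pderiv (of_nat (k + m - 1) * r) =
        pderiv (of_nat (2 * k + m) * (X * q) - of_nat (Suc k) * p)"
      using zonal_recurrence[OF m, of k] by (simp add: X_def p_def q_def r_def)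
    then have "of_nat (k + m - 1) * pderiv r = of_nat (2 * k + m) * (pderiv X * q + X * pderiv q)
        - of_nat (Suc k) * pderiv p"
      unfolding pderiv_diff const pderiv_mult[of X q] by (simp add: algebra_simps)
    moreover have "pderiv X = 1" by (simp add: X_def pderiv_pCons)
    ultimately show ?thesis by (simp add: n K_def N_def algebra_simps)
  qed
  have 1: "(1 - X\<^sup>2) * pderiv q = (N + 1) * (X * q - r)"
    unfolding B right_diff_distrib[of "N + 1"] rec by (simp add: algebra_simps)
  have "(N + 1) * ((1 - X\<^sup>2) * pderiv r) = (N + 1) * ((K + 2) * (q - X * r))"
  proof -
    have "(N + 1) * ((1 - X\<^sup>2) * pderiv r) = (1 - X\<^sup>2) * ((N + 1) * pderiv r)" by simp
    also have "\<dots> = (K + N + 2) * ((1 - X\<^sup>2) * q + X * ((1 - X\<^sup>2) * pderiv q))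
        - (K + 1) * ((1 - X\<^sup>2) * pderiv p)"
      unfolding drec by (simp add: algebra_simps)
    also have "\<dots> = (K + 2) * ((N + 1) * q - X * ((N + 1) * r))"
      unfolding A B rec by (simp add: algebra_simps power2_eq_square)
    finally show ?thesis by (simp add: algebra_simps)
  qed
  moreover have "N + 1 \<noteq> 0"
    unfolding N_def by (metis of_nat_1 of_nat_add of_nat_eq_0_iff add_is_0 one_neq_zero)
  ultimately have 2: "(1 - X\<^sup>2) * pderiv r = (K + 2) * (q - X * r)" by simp
  show "(1 - [:0, 1:]\<^sup>2) * pderiv (zonal m (Suc k))
           = of_nat (Suc k + m - 2) * ([:0, 1:] * zonal m (Suc k) - zonal m (Suc (Suc k)))"
    using 1 by (simp add: n X_def N_def q_def r_def algebra_simps)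
  show "(1 - [:0, 1:]\<^sup>2) * pderiv (zonal m (Suc (Suc k)))
           = of_nat (Suc (Suc k)) * (zonal m (Suc k) - [:0, 1:] * zonal m (Suc (Suc k)))"
    using 2 by (simp add: X_def K_def q_def r_def algebra_simps)
qed

text \<open>
  Differentiating the lowering identity for \<open>P\<^sub>k\<close> and eliminating the polynomial of degree
  \<open>k - 1\<close> and its derivative with the raising identity leaves an equation in \<open>P\<^sub>k\<close> alone, multiplied
  by \<open>1 - X\<^sup>2\<close>, which cancels.
\<close>

lemma zonal_ode:
  assumes m: "m \<ge> 2"
  shows "(1 - [:0, 1:]\<^sup>2) * pderiv (pderiv (zonal m k)) + of_nat (k * (k + m - 2)) * zonal m k
           = of_nat (m - 1) * ([:0, 1:] * pderiv (zonal m k))"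
proof (cases k)
  case 0
  then show ?thesis by (simp add: zonal_0)
next
  case (Suc j)
  define X :: "real poly" where "X = [:0, 1:]"
  define J :: "real poly" where "J = of_nat j"
  define p q where "p = zonal m j" and "q = zonal m (Suc j)"
  obtain n where n: "m = n + 2" using m by (metis add.commute le_Suc_ex)
  define N :: "real poly" where "N = of_nat n"
  have A: "(1 - X\<^sup>2) * pderiv p = (J + N) * (X * p - q)"
    and B: "(1 - X\<^sup>2) * pderiv q = (J + 1) * (p - X * q)"
    using zonal_pderiv_pair[OF m, of j]
    by (simp_all add: n X_def J_def N_def p_def q_def algebra_simps)
  have X': "pderiv X = 1" by (simp add: X_def pderiv_pCons)
  note const = pderiv_of_nat_mult
  have "pderiv ((1 - X\<^sup>2) * pderiv q) = pderiv (of_nat (Suc j) * (p - X * q))"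
    using B by (simp add: J_def add.commute)
  then have dB: "(1 - X\<^sup>2) * pderiv (pderiv q) - 2 * X * pderiv q
      = (J + 1) * (pderiv p - q - X * pderiv q)"
    by (simp only: pderiv_diff const pderiv_mult[of "1 - X * X"] pderiv_mult[of X] power2_eq_square X')
       (simp add: J_def algebra_simps)
  have "(1 - X\<^sup>2) * ((1 - X\<^sup>2) * pderiv (pderiv q) + (J + 1) * (J + 1 + N) * q)
      = (1 - X\<^sup>2) * ((N + 1) * (X * pderiv q))"
  proof -
    have "(1 - X\<^sup>2) * ((1 - X\<^sup>2) * pderiv (pderiv q))
        = (1 - X\<^sup>2) * ((1 - X\<^sup>2) * pderiv (pderiv q) - 2 * X * pderiv q) + 2 * X * ((1 - X\<^sup>2) * pderiv q)"
      by (simp add: algebra_simps)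
    also have "\<dots> = (J + 1) * ((1 - X\<^sup>2) * pderiv p - (1 - X\<^sup>2) * q - X * ((1 - X\<^sup>2) * pderiv q))
        + 2 * X * ((1 - X\<^sup>2) * pderiv q)"
      unfolding dB by (simp add: algebra_simps)
    finally have "(1 - X\<^sup>2) * ((1 - X\<^sup>2) * pderiv (pderiv q)) =
       (J + 1) * ((J + N) * (X * p - q) - (1 - X\<^sup>2) * q - X * ((J + 1) * (p - X * q)))
        + 2 * X * ((J + 1) * (p - X * q))"
      unfolding A B .
    moreover have "(1 - X\<^sup>2) * ((N + 1) * (X * pderiv q)) = (N + 1) * X * ((J + 1) * (p - X * q))"
      unfolding B[symmetric] by (simp add: algebra_simps)
    ultimately show ?thesis by (simp add: algebra_simps power2_eq_square)
  qed
  moreover have "poly (1 - X\<^sup>2) 0 \<noteq> 0" by (simp add: X_def)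
  then have "1 - X\<^sup>2 \<noteq> 0" by (metis poly_0)
  ultimately have "(1 - X\<^sup>2) * pderiv (pderiv q) + (J + 1) * (J + 1 + N) * q = (N + 1) * (X * pderiv q)"
    by (metis mult_cancel_left)
  then show ?thesis
    by (simp add: Suc n X_def J_def N_def q_def algebra_simps)
qed

text \<open>
  The differential equation read off at the coefficient of \<open>X\<^sup>j\<close>. In this form it is exactly the
  condition for the zonal harmonics below to be annihilated by the Laplacian.
\<close>

lemma coeff_zonal_recurrence:
  assumes m: "m \<ge> 2" and "j \<le> k"
  shows "real (j + 2) * real (j + 1) * coeff (zonal m k) (j + 2)
       + real (k - j) * real (k + j + m - 2) * coeff (zonal m k) j = 0"
proof -
  obtain n where n: "m = n + 2" using m by (metis add.commute le_Suc_ex)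
  obtain i where k: "k = j + i" using assms(2) by (metis le_Suc_ex)
  define c where "c = coeff (zonal m k)"
  have sq: "[:0, 1:]\<^sup>2 * p = pCons 0 (pCons 0 p)" for p :: "real poly"
    by (simp add: power2_eq_square)
  have sh: "[:0, 1:] * p = pCons 0 p" for p :: "real poly" by simp
  have ofn: "of_nat i * p = smult (real i) p" for i and p :: "real poly"
    by (simp add: of_nat_poly)
  have a: "coeff (pCons 0 (pderiv p)) i = real i * coeff p i" for p :: "real poly" and i
    by (cases i) (auto simp: coeff_pderiv)
  have b: "coeff (pCons 0 (pCons 0 (pderiv (pderiv p)))) i = real i * (real i - 1) * coeff p i"
    for p :: "real poly" and i
    by (cases i; cases "i - 1") (auto simp: coeff_pderiv algebra_simps)
  have "coeff ((1 - [:0, 1:]\<^sup>2) * pderiv (pderiv (zonal m k)) + of_nat (k * (k + m - 2)) * zonal m k) j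
      = coeff (of_nat (m - 1) * ([:0, 1:] * pderiv (zonal m k))) j"
    using zonal_ode[OF m] by simp
  then have "real (Suc j) * (real (Suc (Suc j)) * c (Suc (Suc j))) - real j * (real j - 1) * c j
      + real (k * (k + m - 2)) * c j = real (m - 1) * (real j * c j)"
    unfolding c_def left_diff_distrib[of 1] mult_1_left sq sh ofn coeff_add coeff_diff coeff_smult a b
      coeff_pderiv .
  moreover have nat: "k + m - 2 = k + n" "m - 1 = n + 1" "k - j = i" "k + j + m - 2 = k + j + n"
    by (simp_all add: n k)
  ultimately have "real (Suc j) * (real (Suc (Suc j)) * c (Suc (Suc j))) - real j * (real j - 1) * c j
      + real (k * (k + n)) * c j = real (n + 1) * (real j * c j)"
    by (simp only:)
  then show ?thesis unfolding c_def[symmetric] nat by (simp add: k algebra_simps)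
qed

lemma lead_coeff_zonal_pos:
  assumes m: "m \<ge> 2"
  shows "coeff (zonal m k) k > 0"
proof (induction k rule: induct_nat_012)
  case (ge2 k)
  have ofn: "of_nat i * p = smult (real i) p" for i and p :: "real poly"
    by (simp add: of_nat_poly)
  have z: "coeff (zonal m k) (Suc (Suc k)) = 0"
    using coeff_zonal_nonzero[of m k "Suc (Suc k)"] by auto
  have "coeff (of_nat (k + m - 1) * zonal m (Suc (Suc k))) (Suc (Suc k))
     = coeff (of_nat (2 * k + m) * ([:0, 1:] * zonal m (Suc k)) - of_nat (Suc k) * zonal m k) (Suc (Suc k))"
    by (simp only: zonal_recurrence[OF m])
  then have "real (k + m - 1) * coeff (zonal m (Suc (Suc k))) (Suc (Suc k))
      = real (2 * k + m) * coeff (zonal m (Suc k)) (Suc k)"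
    unfolding ofn by (simp add: z)
  also have "\<dots> > 0" using ge2 m by (intro mult_pos_pos) auto
  finally show ?case by (simp add: zero_less_mult_iff)
qed (use m in \<open>auto simp: zonal_0 zonal_1\<close>)


section \<open>Partial derivatives of polynomials in several variables\<close>

lemma rpoly_induct [case_names single add]:
  fixes p :: rpoly
  assumes single: "\<And>\<alpha> c. P (Poly_Mapping.single \<alpha> c)"
    and add: "\<And>p q. P p \<Longrightarrow> P q \<Longrightarrow> P (p + q)"
  shows "P p"
proof (induction p rule: Poly_Mapping.update_induct)
  case const
  show ?case using single[of 0 0] by simp
next
  case (update f a b)
  have "Poly_Mapping.update a b f = f + Poly_Mapping.single a b"
    using update(1) by (intro poly_mapping_eqI)
      (auto simp: lookup_update lookup_add lookup_single when_def in_keys_iff)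
  then show ?case using single add update by simp
qed

lemma partial_deriv_single:
  "partial_deriv i (Poly_Mapping.single \<alpha> c)
     = Poly_Mapping.single (\<alpha> - Poly_Mapping.single i 1) (real (Poly_Mapping.lookup \<alpha> i) * c)"
  by (simp add: partial_deriv_def)

lemma partial_deriv_add: "partial_deriv i (p + q) = partial_deriv i p + partial_deriv i q"
  unfolding partial_deriv_def
  by (rule setsum_keys_plus_distrib) (simp_all add: distrib_left single_add)

lemma partial_deriv_0 [simp]: "partial_deriv i 0 = 0"
  by (simp add: partial_deriv_def)

lemma partial_deriv_sum: "partial_deriv i (\<Sum>a\<in>A. f a) = (\<Sum>a\<in>A. partial_deriv i (f a))"
  by (induction A rule: infinite_finite_induct) (simp_all add: partial_deriv_add)

text \<open>
  By bilinearity it suffices to treat monomials. There the truncated subtraction in the exponent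
  is compatible with multiplication whenever the exponent of the variable is positive; otherwise
  the coefficient vanishes.
\<close>

lemma partial_deriv_mult:
  "partial_deriv i (p * q) = partial_deriv i p * q + p * partial_deriv i q"
proof (induction p rule: rpoly_induct)
  case (single \<alpha> c)
  show ?case
  proof (induction q rule: rpoly_induct)
    case (single \<beta> d)
    have "Poly_Mapping.single (\<alpha> + \<beta> - Poly_Mapping.single i 1) (real (Poly_Mapping.lookup \<alpha> i) * c * d)
        = Poly_Mapping.single (\<alpha> - Poly_Mapping.single i 1 + \<beta>) (real (Poly_Mapping.lookup \<alpha> i) * c * d)"
      if "Poly_Mapping.lookup \<alpha> i > 0" for \<alpha> \<beta> :: "nat \<Rightarrow>\<^sub>0 nat" and c d
    proof -
      have "\<alpha> + \<beta> - Poly_Mapping.single i 1 = \<alpha> - Poly_Mapping.single i 1 + \<beta>"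
        using that by (intro poly_mapping_eqI)
          (auto simp: lookup_add lookup_minus lookup_single when_def)
      then show ?thesis by simp
    qed
    then have shift: "Poly_Mapping.single (\<alpha> + \<beta> - Poly_Mapping.single i 1) (real (Poly_Mapping.lookup \<alpha> i) * c * d)
        = Poly_Mapping.single (\<alpha> - Poly_Mapping.single i 1 + \<beta>) (real (Poly_Mapping.lookup \<alpha> i) * c * d)"
        for \<alpha> \<beta> :: "nat \<Rightarrow>\<^sub>0 nat" and c d
      by (cases "Poly_Mapping.lookup \<alpha> i = 0") auto
    show ?case
      using shift[of \<alpha> \<beta> c d] shift[of \<beta> \<alpha> d c]
      by (simp add: mult_single partial_deriv_single lookup_add single_add algebra_simps)
  qed (simp add: distrib_left partial_deriv_add)
qed (simp add: distrib_right partial_deriv_add)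

lemma partial_deriv_commute:
  "partial_deriv i (partial_deriv j p) = partial_deriv j (partial_deriv i p)"
proof (induction p rule: rpoly_induct)
  case (single \<alpha> c)
  have "\<alpha> - Poly_Mapping.single i 1 - Poly_Mapping.single j 1
      = \<alpha> - Poly_Mapping.single j 1 - Poly_Mapping.single i 1"
    by (simp add: poly_mapping_eqI lookup_minus)
  then show ?case
    by (cases "i = j") (auto simp: partial_deriv_single lookup_minus lookup_single mult_ac)
qed (simp add: partial_deriv_add)

abbreviation Const :: "real \<Rightarrow> rpoly" where
  "Const c \<equiv> Poly_Mapping.single 0 c"

definition Var :: "nat \<Rightarrow> rpoly" where
  "Var i = Poly_Mapping.single (Poly_Mapping.single i 1) 1"

lemma Const_mult: "Const (a * b) = Const a * Const b"
  by (simp add: mult_single)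

lemma partial_deriv_Const [simp]: "partial_deriv i (Const c) = 0"
  by (simp add: partial_deriv_single)

lemma partial_deriv_Const_mult: "partial_deriv i (Const c * p) = Const c * partial_deriv i p"
  by (simp add: partial_deriv_mult)

lemma partial_deriv_Var: "partial_deriv i (Var j) = (if i = j then 1 else 0)"
  by (simp add: Var_def partial_deriv_single lookup_single when_def)

lemma partial_deriv_power:
  "partial_deriv i (p ^ k) = of_nat k * p ^ (k - 1) * partial_deriv i p"
proof (induction k)
  case (Suc k)
  then show ?case by (cases k) (simp_all add: partial_deriv_mult algebra_simps)
qed (simp flip: single_one)

text \<open>
  The constant coefficient is evaluation at the origin, hence multiplicative.
\<close>

lemma lookup_0_mult: "Poly_Mapping.lookup (p * q) 0 = Poly_Mapping.lookup p 0 * Poly_Mapping.lookup q (0 :: nat \<Rightarrow>\<^sub>0 nat)"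
  for p q :: rpoly
proof (induction p rule: rpoly_induct)
  case (single \<alpha> c)
  show ?case
  proof (induction q rule: rpoly_induct)
    case (single \<beta> d)
    have "\<alpha> + \<beta> = 0 \<longleftrightarrow> \<alpha> = 0 \<and> \<beta> = 0"
      by (auto simp: poly_mapping_eq_iff fun_eq_iff lookup_add)
    then show ?case by (auto simp: mult_single lookup_single when_def)
  qed (simp add: distrib_left lookup_add)
qed (simp add: distrib_right lookup_add)


section \<open>The Fischer inner product\<close>

text \<open>
  For polynomials homogeneous of degree \<open>k\<close> this is \<open>k!\<close> times the Fischer (or Bombieri) inner
  product \<open>\<Sum>\<^sub>\<alpha> \<alpha>! p\<^sub>\<alpha> q\<^sub>\<alpha>\<close>: it sums the products of the corresponding \<open>k\<close>-th order derivatives at the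
  origin over all sequences of \<open>k\<close> variables. The recursive form makes
  adjointness and positivity short inductions on \<open>k\<close>.
\<close>

fun fischer :: "nat \<Rightarrow> nat \<Rightarrow> rpoly \<Rightarrow> rpoly \<Rightarrow> real" where
  "fischer m 0 p q = Poly_Mapping.lookup p 0 * Poly_Mapping.lookup q 0"
| "fischer m (Suc k) p q = (\<Sum>i<m. fischer m k (partial_deriv i p) (partial_deriv i q))"

lemma fischer_commute: "fischer m k p q = fischer m k q p"
  by (induction k arbitrary: p q) (auto intro!: sum.cong)

lemma fischer_add_left: "fischer m k (p + p') q = fischer m k p q + fischer m k p' q"
  by (induction k arbitrary: p p' q)
     (simp_all add: lookup_add distrib_right partial_deriv_add sum.distrib)

lemma fischer_Const_mult_left: "fischer m k (Const c * p) q = c * fischer m k p q"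
  by (induction k arbitrary: p q)
     (simp_all add: lookup_0_mult partial_deriv_Const_mult sum_distrib_left)

lemma fischer_0_left [simp]: "fischer m k 0 q = 0"
  using fischer_Const_mult_left[of m k 0 0 q] by simp

lemma fischer_sum_left: "fischer m k (\<Sum>a\<in>A. f a) q = (\<Sum>a\<in>A. fischer m k (f a) q)"
  by (induction A rule: infinite_finite_induct) (simp_all add: fischer_add_left)

lemma fischer_sum_right: "fischer m k p (\<Sum>a\<in>A. f a) = (\<Sum>a\<in>A. fischer m k p (f a))"
  using fischer_sum_left[of m k f A p] by (simp only: fischer_commute)

lemma fischer_Const_mult_right: "fischer m k p (Const c * q) = c * fischer m k p q"
  using fischer_Const_mult_left[of m k c q p] by (simp only: fischer_commute)

text \<open>
  The product rule splits off one term in which the variable disappears; in the others the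
  variable is moved across by induction, and these add up to \<open>k - 1\<close> further copies of the same
  term because partial derivatives commute.
\<close>

lemma fischer_Var_mult_left:
  assumes "i < m"
  shows "fischer m k (Var i * p) q = real k * fischer m (k - 1) p (partial_deriv i q)"
proof (induction k arbitrary: p q)
  case 0
  have "Poly_Mapping.single i (1::nat) \<noteq> 0"
    by (metis lookup_single_eq lookup_zero zero_neq_one)
  then show ?case by (simp add: Var_def lookup_0_mult lookup_single when_def)
next
  case (Suc k)
  have "fischer m (Suc k) (Var i * p) q
      = (\<Sum>j<m. fischer m k ((if j = i then p else 0) + Var i * partial_deriv j p) (partial_deriv j q))"
    by (auto simp: partial_deriv_mult partial_deriv_Var intro!: sum.cong)
  also have "\<dots> = (\<Sum>j<m. if j = i then fischer m k p (partial_deriv i q) else 0)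
      + (\<Sum>j<m. fischer m k (Var i * partial_deriv j p) (partial_deriv j q))"
  proof -
    have "fischer m k (if j = i then p else 0) (partial_deriv j q)
        = (if j = i then fischer m k p (partial_deriv i q) else 0)" for j
      by simp
    then show ?thesis by (simp only: fischer_add_left sum.distrib)
  qed
  also have "(\<Sum>j<m. fischer m k (Var i * partial_deriv j p) (partial_deriv j q))
      = real k * fischer m k p (partial_deriv i q)"
  proof -
    have "fischer m k (Var i * partial_deriv j p) (partial_deriv j q)
        = real k * fischer m (k - 1) (partial_deriv j p) (partial_deriv j (partial_deriv i q))" for j
      by (subst Suc) (simp only: partial_deriv_commute[of j i])
    note * = this
    show ?thesis unfolding * by (cases k) (simp_all add: sum_distrib_left)
  qed
  finally show ?case using assms by (simp add: algebra_simps)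
qed

lemma fischer_Var_mult_right:
  assumes "i < m"
  shows "fischer m k p (Var i * q) = real k * fischer m (k - 1) (partial_deriv i p) q"
  using fischer_Var_mult_left[OF assms, of k q p] by (simp only: fischer_commute)

text \<open>
  A Schur product theorem: the Fischer product is a sum of products of numbers \<open>r(c) r(c')\<close>,
  and against each of these summands \<open>H\<close> is nonnegative by assumption. The recursion over the
  derivatives exhibits these numbers without an explicit Gram representation.
\<close>

lemma sum_fischer_nonneg:
  assumes "\<And>r. (\<Sum>c\<in>C. \<Sum>c'\<in>C. H c c' * (r c * r c')) \<ge> (0::real)"
  shows "(\<Sum>c\<in>C. \<Sum>c'\<in>C. H c c' * fischer m k (f c) (f c')) \<ge> 0"
proof (induction k arbitrary: f)
  case 0
  then show ?case using assms[of "\<lambda>c. Poly_Mapping.lookup (f c) 0"] by simp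
next
  case (Suc k)
  have "(\<Sum>c\<in>C. \<Sum>c'\<in>C. H c c' * fischer m (Suc k) (f c) (f c'))
     = (\<Sum>i<m. \<Sum>c\<in>C. \<Sum>c'\<in>C. H c c' * fischer m k (partial_deriv i (f c)) (partial_deriv i (f c')))"
    by (simp add: sum_distrib_left sum.swap[of _ _ "{..<m}"])
  also have "\<dots> \<ge> 0" by (intro sum_nonneg Suc)
  finally show ?case .
qed


section \<open>Zonal harmonics\<close>

definition linear_form :: "nat \<Rightarrow> (nat \<Rightarrow> real) \<Rightarrow> rpoly" where
  "linear_form m y = (\<Sum>i<m. Const (y i) * Var i)"

definition radius_sq :: "nat \<Rightarrow> rpoly" where
  "radius_sq m = (\<Sum>i<m. Var i ^ 2)"

lemma partial_deriv_linear_form: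
  assumes "i < m"
  shows "partial_deriv i (linear_form m y) = Const (y i)"
proof -
  have "partial_deriv i (linear_form m y) = (\<Sum>j<m. if i = j then Const (y j) else 0)"
    unfolding linear_form_def partial_deriv_sum
    by (intro sum.cong refl) (simp add: partial_deriv_Const_mult partial_deriv_Var)
  then show ?thesis using assms by simp
qed

lemma partial_deriv_radius_sq:
  assumes "i < m"
  shows "partial_deriv i (radius_sq m) = 2 * Var i"
proof -
  have "partial_deriv i (radius_sq m) = (\<Sum>j<m. if i = j then 2 * Var j else 0)"
    unfolding radius_sq_def partial_deriv_sum
    by (intro sum.cong refl) (simp add: partial_deriv_power partial_deriv_Var)
  then show ?thesis using assms by simp
qed

text \<open>
  The two summands are the contribution of the second derivative of the power of the linear form,
  and the one of the radius together with the mixed terms, which recombine because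
  \<open>\<Sum>\<^sub>i y\<^sub>i X\<^sub>i\<close> is the linear form again and \<open>\<Sum>\<^sub>i X\<^sub>i\<^sup>2\<close> the squared radius. Truncated exponents
  occur only with a vanishing factor.
\<close>

lemma laplacian_linear_form_power_mult_radius_sq_power:
  "laplacian m (linear_form m y ^ j * radius_sq m ^ l)
     = Const (real j * real (j - 1) * (\<Sum>i<m. (y i)\<^sup>2)) * (linear_form m y ^ (j - 2) * radius_sq m ^ l)
     + Const (2 * real l * (2 * real j + real m + 2 * real l - 2))
         * (linear_form m y ^ j * radius_sq m ^ (l - 1))"
proof -
  define L R where "L = linear_form m y" and "R = radius_sq m"
  have dL: "partial_deriv i L = Const (y i)" and dR: "partial_deriv i R = 2 * Var i" if "i < m" for i
    using that by (simp_all add: L_def R_def partial_deriv_linear_form partial_deriv_radius_sq)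
  have d: "partial_deriv i (L ^ a * R ^ b) = of_nat a * Const (y i) * (L ^ (a - 1) * R ^ b)
      + of_nat (2 * b) * Var i * (L ^ a * R ^ (b - 1))" if "i < m" for i a b
    using that by (simp add: partial_deriv_mult partial_deriv_power dL dR algebra_simps)
  have dc: "partial_deriv i (of_nat a * p) = of_nat a * partial_deriv i p" for i a p
    using partial_deriv_Const_mult[of i "real a" p] by simp
  have "partial_deriv i (partial_deriv i (L ^ j * R ^ l))
     = of_nat (j * (j - 1)) * (Const (y i) ^ 2 * (L ^ (j - 2) * R ^ l))
     + of_nat (4 * l * j) * ((Const (y i) * Var i) * (L ^ (j - 1) * R ^ (l - 1)))
     + of_nat (2 * l) * (L ^ j * R ^ (l - 1))
     + of_nat (4 * l * (l - 1)) * (Var i ^ 2 * (L ^ j * R ^ (l - 2)))"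
    if "i < m" for i
  proof -
    have "partial_deriv i (partial_deriv i (L ^ j * R ^ l))
      = of_nat j * (Const (y i) * partial_deriv i (L ^ (j - 1) * R ^ l))
      + of_nat (2 * l) * (L ^ j * R ^ (l - 1))
      + of_nat (2 * l) * (Var i * partial_deriv i (L ^ j * R ^ (l - 1)))"
      unfolding d[OF that, of j l] partial_deriv_add mult.assoc dc partial_deriv_Const_mult
        partial_deriv_mult[of i "Var i"]
      by (simp add: partial_deriv_Var algebra_simps)
    also have "\<dots> = of_nat j * (Const (y i) * (of_nat (j - 1) * Const (y i) * (L ^ (j - 1 - 1) * R ^ l)
      + of_nat (2 * l) * Var i * (L ^ (j - 1) * R ^ (l - 1))))
      + of_nat (2 * l) * (L ^ j * R ^ (l - 1))
      + of_nat (2 * l) * (Var i * (of_nat j * Const (y i) * (L ^ (j - 1) * R ^ (l - 1))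
      + of_nat (2 * (l - 1)) * Var i * (L ^ j * R ^ (l - 1 - 1))))"
      unfolding d[OF that] ..
    also have "j - 1 - 1 = j - 2" by simp
    also have "l - 1 - 1 = l - 2" by simp
    finally show ?thesis by (simp only: of_nat_mult power2_eq_square) (simp add: algebra_simps)
  qed
  then have "laplacian m (L ^ j * R ^ l) = (\<Sum>i<m. of_nat (j * (j - 1)) * (Const (y i) ^ 2 * (L ^ (j - 2) * R ^ l))
     + of_nat (4 * l * j) * ((Const (y i) * Var i) * (L ^ (j - 1) * R ^ (l - 1)))
     + of_nat (2 * l) * (L ^ j * R ^ (l - 1))
     + of_nat (4 * l * (l - 1)) * (Var i ^ 2 * (L ^ j * R ^ (l - 2))))"
    unfolding laplacian_def by (auto intro!: sum.cong)
  also have "\<dots> = of_nat (j * (j - 1)) * ((\<Sum>i<m. Const (y i) ^ 2) * (L ^ (j - 2) * R ^ l))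
     + of_nat (4 * l * j) * (L * (L ^ (j - 1) * R ^ (l - 1)))
     + of_nat m * (of_nat (2 * l) * (L ^ j * R ^ (l - 1)))
     + of_nat (4 * l * (l - 1)) * (R * (L ^ j * R ^ (l - 2)))"
    unfolding L_def linear_form_def R_def radius_sq_def
    by (simp only: sum.distrib sum_distrib_left[symmetric] sum_distrib_right[symmetric]) simp
  also have "of_nat (4 * l * j) * (L * (L ^ (j - 1) * R ^ (l - 1)))
      = of_nat (4 * l * j) * (L ^ j * R ^ (l - 1))"
    by (cases j) (simp_all add: mult_ac)
  also have "of_nat (4 * l * (l - 1)) * (R * (L ^ j * R ^ (l - 2)))
      = of_nat (4 * l * (l - 1)) * (L ^ j * R ^ (l - 1))"
    by (cases l; cases "l - 1") (simp_all add: mult_ac)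
  also have "(\<Sum>i<m. Const (y i) ^ 2) = Const (\<Sum>i<m. (y i)\<^sup>2)"
  proof -
    have "Const (\<Sum>i\<in>A. f i) = (\<Sum>i\<in>A. Const (f i))" for f :: "nat \<Rightarrow> real" and A
      by (induction A rule: infinite_finite_induct) (simp_all add: single_add)
    then show ?thesis by (simp add: power2_eq_square mult_single)
  qed
  also have "of_nat (j * (j - 1)) * (Const (\<Sum>i<m. (y i)\<^sup>2) * (L ^ (j - 2) * R ^ l))
      = Const (real j * real (j - 1) * (\<Sum>i<m. (y i)\<^sup>2)) * (L ^ (j - 2) * R ^ l)"
    by (simp add: Const_mult mult.assoc)
  also have "Const (real j * real (j - 1) * (\<Sum>i<m. (y i)\<^sup>2)) * (L ^ (j - 2) * R ^ l)
     + of_nat (4 * l * j) * (L ^ j * R ^ (l - 1))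
     + of_nat m * (of_nat (2 * l) * (L ^ j * R ^ (l - 1)))
     + of_nat (4 * l * (l - 1)) * (L ^ j * R ^ (l - 1))
     = Const (real j * real (j - 1) * (\<Sum>i<m. (y i)\<^sup>2)) * (L ^ (j - 2) * R ^ l)
     + of_nat (4 * l * j + m * (2 * l) + 4 * l * (l - 1)) * (L ^ j * R ^ (l - 1))"
    by (simp only: of_nat_add of_nat_mult distrib_right mult.assoc add.assoc)
  also have "of_nat (4 * l * j + m * (2 * l) + 4 * l * (l - 1))
      = Const (real (4 * l * j + m * (2 * l) + 4 * l * (l - 1)))"
    by (simp only: single_of_nat)
  also have "real (4 * l * j + m * (2 * l) + 4 * l * (l - 1))
      = 2 * real l * (2 * real j + real m + 2 * real l - 2)"
    by (cases l) (simp_all add: algebra_simps)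
  finally show ?thesis unfolding L_def R_def .
qed

text \<open>
  The polynomial \<open>x \<mapsto> (\<bar>x\<bar> \<bar>y\<bar>)\<^sup>k P\<^sub>k\<^sup>m(x \<bullet> y / (\<bar>x\<bar> \<bar>y\<bar>))\<close>. The halved exponents are exact wherever the
  coefficient is nonzero, because \<open>P\<^sub>k\<^sup>m\<close> has the parity of \<open>k\<close>.
\<close>

definition zonal_harmonic :: "nat \<Rightarrow> nat \<Rightarrow> (nat \<Rightarrow> real) \<Rightarrow> rpoly" where
  "zonal_harmonic m k y = (\<Sum>j\<le>k.
     Const (coeff (zonal m k) j * (\<Sum>i<m. (y i)\<^sup>2) ^ ((k - j) div 2))
       * (linear_form m y ^ j * radius_sq m ^ ((k - j) div 2)))"

lemma laplacian_sum: "laplacian m (\<Sum>a\<in>A. f a) = (\<Sum>a\<in>A. laplacian m (f a))"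
  unfolding laplacian_def partial_deriv_sum by (rule sum.swap)

lemma laplacian_Const_mult: "laplacian m (Const c * p) = Const c * laplacian m p"
  unfolding laplacian_def partial_deriv_Const_mult sum_distrib_left ..

text \<open>
  The Laplacian of the \<open>j\<close>-th summand consists of a term with the linear form to the power
  \<open>j - 2\<close> and one to the power \<open>j\<close>. Collecting equal powers, the second term of index \<open>j\<close> meets the
  first term of index \<open>j + 2\<close>, and they cancel by the recurrence for the coefficients.
\<close>

lemma laplacian_zonal_harmonic:
  assumes m: "m \<ge> 2"
  shows "laplacian m (zonal_harmonic m k y) = 0"
proof -
  define c where "c = coeff (zonal m k)"
  define N where "N = (\<Sum>i<m. (y i)\<^sup>2)"
  define l where "l = (\<lambda>j. (k - j) div 2)"
  define L R where "L = linear_form m y" and "R = radius_sq m"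
  define A where "A = (\<lambda>j. Const (c j * N ^ l j * (real j * real (j - 1) * N)) * (L ^ (j - 2) * R ^ l j))"
  define B where "B = (\<lambda>j. Const (c j * N ^ l j * (2 * real (l j) * (2 * real j + real m + 2 * real (l j) - 2)))
     * (L ^ j * R ^ (l j - 1)))"
  have zero: "c j = 0" if "j > k" for j
    using coeff_zonal_nonzero[of m k j] that unfolding c_def by auto
  have AB: "A (j + 2) + B j = 0" if "j \<le> k" for j
  proof -
    have rec: "real (j + 2) * real (j + 1) * c (j + 2) + real (k - j) * real (k + j + m - 2) * c j = 0"
      using coeff_zonal_recurrence[OF m that] by (simp add: c_def)
    show ?thesis
    proof (cases "c j = 0")
      case True
      moreover from this have "c (j + 2) = 0" using rec by simp
      ultimately show ?thesis by (simp add: A_def B_def)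
    next
      case False
      then have "even (k - j)" using coeff_zonal_nonzero unfolding c_def by blast
      then have l2: "real (k - j) = 2 * real (l j)"
        unfolding l_def by (metis dvd_mult_div_cancel of_nat_mult of_nat_numeral)
      have nat: "real (k + j + m - 2) = 2 * real j + real m + 2 * real (l j) - 2"
        using m that l2 by (simp add: of_nat_diff)
      have l': "l (j + 2) = l j - 1" unfolding l_def by simp
      have "c (j + 2) * N ^ l (j + 2) * (real (j + 2) * real (j + 1) * N)
          + c j * N ^ l j * (2 * real (l j) * (2 * real j + real m + 2 * real (l j) - 2))
          = N ^ l j * (real (j + 2) * real (j + 1) * c (j + 2) + real (k - j) * real (k + j + m - 2) * c j)"
      proof (cases "l j")
        case 0
        \<comment> \<open>Here \<open>j = k\<close>: the truncated exponent of \<open>N\<close> is harmless because \<open>c (j + 2) = 0\<close>.\<close>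
        then have "j + 2 > k" using l2 by simp
        then show ?thesis using 0 zero l2 by simp
      next
        case (Suc l0)
        then show ?thesis unfolding nat l2 l' by (simp add: algebra_simps)
      qed
      then show ?thesis unfolding rec unfolding A_def B_def l'
        by (simp add: distrib_right[symmetric] single_add[symmetric])
    qed
  qed
  have "laplacian m (zonal_harmonic m k y) = (\<Sum>j\<le>k. A j + B j)"
    unfolding zonal_harmonic_def laplacian_sum laplacian_Const_mult
      laplacian_linear_form_power_mult_radius_sq_power A_def B_def c_def N_def l_def L_def R_def
    by (intro sum.cong refl) (simp only: distrib_left Const_mult mult.assoc)
  also have "\<dots> = (\<Sum>j\<le>k. A j) + (\<Sum>j\<le>k. B j)" by (rule sum.distrib)
  \<comment> \<open>The range is extended by two vanishing terms so that the shift by two below loses none.\<close>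
  also have "(\<Sum>j\<le>k. A j) = (\<Sum>j\<le>k + 2. A j)"
    by (rule sum.mono_neutral_left) (auto simp: A_def zero)
  also have "\<dots> = (\<Sum>j\<le>k. A (j + 2))"
  proof -
    have "A 0 = 0" "A 1 = 0" by (simp_all add: A_def)
    then show ?thesis
      by (simp add: sum.atMost_Suc_shift del: sum.atMost_Suc)
  qed
  also have "\<dots> + (\<Sum>j\<le>k. B j) = (\<Sum>j\<le>k. A (j + 2) + B j)" by (rule sum.distrib[symmetric])
  also have "\<dots> = 0" using AB by (intro sum.neutral) auto
  finally show ?thesis .
qed

text \<open>
  Applying adjointness twice in each variable: multiplication by the squared radius is adjoint to the
  Laplacian. Hence harmonic polynomials are orthogonal to multiples of the squared radius.
\<close>

lemma fischer_radius_sq_mult_left: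
  "fischer m k (radius_sq m * p) q = real k * real (k - 1) * fischer m (k - 2) p (laplacian m q)"
proof -
  have "fischer m k (radius_sq m * p) q = (\<Sum>i<m. fischer m k (Var i * (Var i * p)) q)"
    by (simp add: radius_sq_def power2_eq_square sum_distrib_right fischer_sum_left mult.assoc)
  also have "\<dots> = (\<Sum>i<m. real k * real (k - 1) * fischer m (k - 2) p (partial_deriv i (partial_deriv i q)))"
    by (intro sum.cong refl) (simp add: fischer_Var_mult_left numeral_2_eq_2)
  finally show ?thesis by (simp add: laplacian_def fischer_sum_right sum_distrib_left)
qed

lemma fischer_linear_form_power_linear_form_mult:
  "fischer m (Suc k) (linear_form m z ^ Suc k) (linear_form m y * q)
     = (real (Suc k))\<^sup>2 * (\<Sum>i<m. y i * z i) * fischer m k (linear_form m z ^ k) q"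
proof -
  have "fischer m (Suc k) (linear_form m z ^ Suc k) (linear_form m y * q)
      = (\<Sum>i<m. y i * fischer m (Suc k) (linear_form m z ^ Suc k) (Var i * q))"
    by (simp only: linear_form_def[of m y] sum_distrib_right fischer_sum_right mult.assoc fischer_Const_mult_right)
  also have "\<dots> = (\<Sum>i<m. y i * (real (Suc k) * (real (Suc k) * z i * fischer m k (linear_form m z ^ k) q)))"
  proof (intro sum.cong refl)
    fix i assume i: "i \<in> {..<m}"
    have "partial_deriv i (linear_form m z ^ Suc k) = Const (real (Suc k) * z i) * linear_form m z ^ k"
      using i by (simp only: partial_deriv_power partial_deriv_linear_form lessThan_iff Const_mult single_of_nat)
         (simp add: mult_ac)
    then show "y i * fischer m (Suc k) (linear_form m z ^ Suc k) (Var i * q)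
        = y i * (real (Suc k) * (real (Suc k) * z i * fischer m k (linear_form m z ^ k) q))"
      using i by (simp only: fischer_Var_mult_right lessThan_iff fischer_Const_mult_left diff_Suc_1)
  qed
  finally show ?thesis
    by (simp add: sum_distrib_left sum_distrib_right power2_eq_square mult_ac del: of_nat_Suc)
qed

lemma fischer_linear_form_power_radius_sq_mult:
  "fischer m (Suc (Suc k)) (linear_form m z ^ Suc (Suc k)) (radius_sq m * q)
     = (real (Suc (Suc k)))\<^sup>2 * (real (Suc k))\<^sup>2 * (\<Sum>i<m. (z i)\<^sup>2) * fischer m k (linear_form m z ^ k) q"
proof -
  have der: "partial_deriv i (linear_form m z ^ Suc k) = Const (real (Suc k) * z i) * linear_form m z ^ k"
    if "i < m" for i k
    using that by (simp only: partial_deriv_power partial_deriv_linear_form Const_mult single_of_nat)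
       (simp add: mult_ac)
  have "fischer m (Suc (Suc k)) (linear_form m z ^ Suc (Suc k)) (radius_sq m * q)
      = (\<Sum>i<m. fischer m (Suc (Suc k)) (linear_form m z ^ Suc (Suc k)) (Var i * (Var i * q)))"
    by (simp only: radius_sq_def sum_distrib_right fischer_sum_right mult.assoc power2_eq_square)
  also have "\<dots> = (\<Sum>i<m. (real (Suc (Suc k)))\<^sup>2 * (real (Suc k))\<^sup>2 * (z i)\<^sup>2 * fischer m k (linear_form m z ^ k) q)"
    by (intro sum.cong refl)
       (simp only: lessThan_iff der fischer_Var_mult_right fischer_Const_mult_left diff_Suc_1 power2_eq_square,
        simp only: mult_ac)
  finally show ?thesis
    by (simp add: sum_distrib_left sum_distrib_right)
qed

text \<open>
  Pairing with the \<open>k\<close>-th power of \<open>z \<bullet> x\<close> evaluates at \<open>z\<close>, up to the factor \<open>(k!)\<^sup>2\<close>: each factor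
  of the right argument is moved to the left as a derivative, where it produces its own value
  at \<open>z\<close> and lowers the power of the linear form. Adjointness and the power rule each contribute one
  factor \<open>k!\<close>.
\<close>

lemma fischer_linear_form_power:
  "fischer m (j + 2 * l) (linear_form m z ^ (j + 2 * l)) (linear_form m y ^ j * radius_sq m ^ l)
     = (fact (j + 2 * l))\<^sup>2 * (\<Sum>i<m. y i * z i) ^ j * (\<Sum>i<m. (z i)\<^sup>2) ^ l"
proof (induction j)
  case 0
  show ?case
  proof (induction l)
    case (Suc l)
    have "0 + 2 * Suc l = Suc (Suc (2 * l))" by simp
    then show ?case using Suc fischer_linear_form_power_radius_sq_mult[of m "2 * l" z "radius_sq m ^ l"]
      by (simp add: power2_eq_square algebra_simps)
  qed simp
next
  case (Suc j)
  then show ?case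
    using fischer_linear_form_power_linear_form_mult[of m "j + 2 * l" z y "linear_form m y ^ j * radius_sq m ^ l"]
    by (simp add: power2_eq_square mult.assoc algebra_simps)
qed

text \<open>
  The value at \<open>x\<close> of the zonal harmonic of \<open>y\<close>. It is \<open>Qpoly m k u v t\<close> with the coordinate
  expressions of \<open>x \<bullet> y\<close>, \<open>\<bar>x\<bar>\<^sup>2\<close> and \<open>\<bar>y\<bar>\<^sup>2\<close> in place of \<open>t - u v\<close>, \<open>1 - u\<^sup>2\<close> and \<open>1 - v\<^sup>2\<close>.
\<close>

definition zonal_kernel :: "nat \<Rightarrow> nat \<Rightarrow> (nat \<Rightarrow> real) \<Rightarrow> (nat \<Rightarrow> real) \<Rightarrow> real" where
  "zonal_kernel m k x y = (\<Sum>j\<le>k. coeff (zonal m k) j * (\<Sum>i<m. x i * y i) ^ j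
     * ((\<Sum>i<m. (x i)\<^sup>2) * (\<Sum>i<m. (y i)\<^sup>2)) ^ ((k - j) div 2))"

lemma fischer_linear_form_power_zonal_harmonic:
  "fischer m k (linear_form m x ^ k) (zonal_harmonic m k y) = (fact k)\<^sup>2 * zonal_kernel m k x y"
proof -
  have "coeff (zonal m k) j * (\<Sum>i<m. (y i)\<^sup>2) ^ ((k - j) div 2) *
      fischer m k (linear_form m x ^ k) (linear_form m y ^ j * radius_sq m ^ ((k - j) div 2))
      = (fact k)\<^sup>2 * (coeff (zonal m k) j * (\<Sum>i<m. x i * y i) ^ j
          * ((\<Sum>i<m. (x i)\<^sup>2) * (\<Sum>i<m. (y i)\<^sup>2)) ^ ((k - j) div 2))" for j
  proof (cases "coeff (zonal m k) j = 0")
    case False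
    then have "j + 2 * ((k - j) div 2) = k" using coeff_zonal_nonzero[of m k j] by auto
    then show ?thesis
      using fischer_linear_form_power[of m j "(k - j) div 2" x y]
      by (simp add: power_mult_distrib mult_ac)
  qed simp
  then show ?thesis
    unfolding zonal_harmonic_def zonal_kernel_def sum_distrib_left fischer_sum_right
    by (simp only: fischer_Const_mult_right)
qed

text \<open>
  In the left argument only the summand with the pure power of the linear form survives, since all
  others are multiples of the squared radius and the right argument is harmonic. The surviving
  summand evaluates the right argument. So the zonal kernel is a Gram kernel.
\<close>

lemma fischer_zonal_harmonic:
  assumes "m \<ge> 2"
  shows "fischer m k (zonal_harmonic m k x) (zonal_harmonic m k y)
           = coeff (zonal m k) k * (fact k)\<^sup>2 * zonal_kernel m k x y"
proof -
  define f where "f = zonal_harmonic m k y"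
  have vanish: "fischer m k (linear_form m x ^ j * radius_sq m ^ Suc l) f = 0" for j l
    using fischer_radius_sq_mult_left[of m k "linear_form m x ^ j * radius_sq m ^ l" f]
      laplacian_zonal_harmonic[OF assms, of k y] fischer_commute[of m "k - 2" _ 0]
    by (simp add: f_def mult_ac)
  define T where "T = (\<lambda>j. coeff (zonal m k) j * (\<Sum>i<m. (x i)\<^sup>2) ^ ((k - j) div 2)
        * fischer m k (linear_form m x ^ j * radius_sq m ^ ((k - j) div 2)) f)"
  have zero: "T j = 0" if "j < k" for j
  proof (cases "coeff (zonal m k) j = 0")
    case False
    then have "even (k - j)" using coeff_zonal_nonzero by blast
    with that have "(k - j) div 2 \<noteq> 0" by presburger
    then obtain l where "(k - j) div 2 = Suc l" using not0_implies_Suc by blast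
    then show ?thesis by (simp only: T_def vanish mult_zero_right)
  qed (simp add: T_def)
  have "fischer m k (zonal_harmonic m k x) f = (\<Sum>j\<le>k. T j)"
    unfolding zonal_harmonic_def[of m k x] T_def
    by (simp only: fischer_sum_left fischer_Const_mult_left)
  also have "\<dots> = (\<Sum>j<k. T j) + T k" by (metis lessThan_Suc_atMost sum.lessThan_Suc)
  also have "\<dots> = coeff (zonal m k) k * fischer m k (linear_form m x ^ k) f"
  proof -
    have "(\<Sum>j<k. T j) = 0" using zero by simp
    moreover have "T k = coeff (zonal m k) k * fischer m k (linear_form m x ^ k) f"
      by (simp add: T_def)
    ultimately show ?thesis by simp
  qed
  finally show ?thesis
    by (simp add: f_def fischer_linear_form_power_zonal_harmonic)
qed

lemma sum_zonal_kernel_nonneg: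
  assumes m: "m \<ge> 2"
    and H: "\<And>r. (\<Sum>c\<in>C. \<Sum>c'\<in>C. H c c' * (r c * r c')) \<ge> (0::real)"
  shows "(\<Sum>c\<in>C. \<Sum>c'\<in>C. H c c' * zonal_kernel m k (\<xi> c) (\<xi> c')) \<ge> 0"
proof -
  define a where "a = coeff (zonal m k) k * (fact k)\<^sup>2"
  have "a > 0" using lead_coeff_zonal_pos[OF m] by (simp add: a_def)
  moreover have "a * (\<Sum>c\<in>C. \<Sum>c'\<in>C. H c c' * zonal_kernel m k (\<xi> c) (\<xi> c')) \<ge> 0"
    using sum_fischer_nonneg[OF H, of m k "\<lambda>c. zonal_harmonic m k (\<xi> c)"]
    by (simp add: fischer_zonal_harmonic[OF m] a_def sum_distrib_left mult_ac)
  ultimately show ?thesis by (simp add: zero_le_mult_iff)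
qed


section \<open>Positivity of the matrix sums over a code\<close>

text \<open>
  Cartesian coordinates of the projection to the orthogonal complement of \<open>e\<close>, numbered by
  \<open>0, \<dots>, n - 2\<close>: rotate \<open>e\<close> to a coordinate axis and drop the coordinate along it.
\<close>

lemma ex_coordinates_orthogonal_complement:
  fixes e :: "real^'n"
  assumes "norm e = 1"
  obtains \<xi> :: "real^'n \<Rightarrow> nat \<Rightarrow> real"
  where "\<And>x y. (\<Sum>i<CARD('n) - 1. \<xi> x i * \<xi> y i) = x \<bullet> y - (e \<bullet> x) * (e \<bullet> y)"
proof -
  fix a :: 'n
  have "norm (axis a 1 :: real^'n) = 1" by (rule norm_axis_1)
  then obtain f :: "real^'n \<Rightarrow> real^'n" where f: "orthogonal_transformation f" "f e = axis a 1"
    using orthogonal_transformation_exists_1[OF assms] by blast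
  have card: "card (UNIV - {a}) = CARD('n) - 1" by (rule card_Diff_singleton) simp
  obtain h where "bij_betw h {0..<card (UNIV - {a})} (UNIV - {a})"
    using ex_bij_betw_nat_finite[OF finite] by blast
  then have h: "bij_betw h {..<CARD('n) - 1} (UNIV - {a})"
    by (simp only: card atLeast0LessThan)
  have "(\<Sum>i<CARD('n) - 1. f x $ h i * f y $ h i) = x \<bullet> y - (e \<bullet> x) * (e \<bullet> y)" for x y
  proof -
    have e: "e \<bullet> x = f x $ a" for x
    proof -
      have "e \<bullet> x = f e \<bullet> f x" using f(1) by (simp add: orthogonal_transformation_def)
      then show ?thesis by (simp add: f(2) inner_axis')
    qed
    have "x \<bullet> y = f x \<bullet> f y" using f by (simp add: orthogonal_transformation_def)
    also have "\<dots> = f x $ a * f y $ a + (\<Sum>i\<in>UNIV - {a}. f x $ i * f y $ i)"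
      unfolding inner_vec_def inner_real_def by (rule sum.remove) auto
    also have "(\<Sum>i\<in>UNIV - {a}. f x $ i * f y $ i) = (\<Sum>i<CARD('n) - 1. f x $ h i * f y $ h i)"
      by (rule sum.reindex_bij_betw[OF h, symmetric])
    finally show ?thesis unfolding e by linarith
  qed
  then show ?thesis by (intro that[of "\<lambda>x i. f x $ h i"])
qed

lemma mat_inner_eq_sum:
  assumes "A \<in> carrier_mat N N" "B \<in> carrier_mat N N"
  shows "mat_inner A B = (\<Sum>i<N. \<Sum>j<N. A $$ (i, j) * B $$ (i, j))"
  using assms by (simp add: mat_inner_def mat_trace_def scalar_prod_def atLeast0LessThan)

lemma pos_semidef_sum_nonneg:
  assumes "pos_semidef A" and A: "A \<in> carrier_mat N N"
  shows "(\<Sum>i<N. \<Sum>j<N. A $$ (i, j) * (x i * x j)) \<ge> 0"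
proof -
  have "0 \<le> scalar_prod (vec N x) (A *\<^sub>v vec N x)"
    using assms by (auto simp: pos_semidef_def)
  also have "\<dots> = (\<Sum>i<N. \<Sum>j<N. A $$ (i, j) * (x i * x j))"
  proof -
    have "x i * (\<Sum>j<N. A $$ (i, j) * x j) = (\<Sum>j<N. A $$ (i, j) * (x i * x j))" for i
      by (simp add: sum_distrib_left mult_ac)
    then show ?thesis using A by (simp add: scalar_prod_def atLeast0LessThan)
  qed
  finally show ?thesis .
qed

lemma Ymat_carrier: "Ymat n d k u v t \<in> carrier_mat (d - k + 1) (d - k + 1)"
  by (simp add: Ymat_def)

text \<open>
  The normalizing constants form a nonnegative matrix of rank one, so that they can be absorbed into
  the vectors to which the quadratic form of \<open>F\<^sub>k\<close> is applied.
\<close>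

lemma lam_factorization:
  obtains \<kappa> s where "\<kappa> \<ge> 0" "\<And>i j. lam n k i j = \<kappa> * (s i * s j)"
proof
  show "omega n / omega (n - 1) * (omega (n + 2 * k - 1) / omega (n + 2 * k)) \<ge> 0"
    by (simp add: omega_def)
  show "lam n k i j = omega n / omega (n - 1) * (omega (n + 2 * k - 1) / omega (n + 2 * k))
      * (sqrt (real (harmonic_dim (n + 2 * k) i)) * sqrt (real (harmonic_dim (n + 2 * k) j)))" for i j
    by (simp add: lam_def real_sqrt_mult)
qed

text \<open>
  The pairing of \<open>A\<close> with \<open>Y\<^sub>k\<close> is a nonnegative multiple of \<open>z(c)\<^sup>T A z(c')\<close> times a zonal kernel
  in the projections orthogonal to \<open>e\<close>. The first factor is a positive semidefinite kernel in \<open>c, c'\<close>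
  because \<open>A\<close> is a positive semidefinite matrix, and weighting a zonal kernel by such a kernel keeps
  the sum over all pairs nonnegative.
\<close>

lemma sum_mat_inner_Ymat_nonneg:
  fixes e :: "real^'n" and C :: "(real^'n) set"
  assumes n: "CARD('n) \<ge> 3" and e: "norm e = 1" and C: "C \<subseteq> sphere 0 1"
    and A: "pos_semidef A" "A \<in> carrier_mat (d - k + 1) (d - k + 1)"
  shows "(\<Sum>c\<in>C. \<Sum>c'\<in>C. mat_inner A (Ymat CARD('n) d k (e \<bullet> c) (e \<bullet> c') (c \<bullet> c'))) \<ge> 0"
proof -
  define n where "n = CARD('n)"
  define N where "N = d - k + 1"
  obtain \<kappa> s where \<kappa>: "\<kappa> \<ge> 0" and lam: "\<And>i j. lam n k i j = \<kappa> * (s i * s j)"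
    using lam_factorization by blast
  obtain \<xi> :: "real^'n \<Rightarrow> nat \<Rightarrow> real"
    where \<xi>: "\<And>x y. (\<Sum>i<n - 1. \<xi> x i * \<xi> y i) = x \<bullet> y - (e \<bullet> x) * (e \<bullet> y)"
    unfolding n_def using ex_coordinates_orthogonal_complement[OF e] by blast
  have Q: "zonal_kernel (n - 1) k (\<xi> c) (\<xi> c') = Qpoly (n - 1) k (e \<bullet> c) (e \<bullet> c') (c \<bullet> c')"
    if "c \<in> C" "c' \<in> C" for c c'
  proof -
    have "(\<Sum>i<n - 1. (\<xi> c i)\<^sup>2) = 1 - (e \<bullet> c)\<^sup>2" if "c \<in> C" for c
    proof -
      have "c \<bullet> c = 1" using C that by (auto simp: dot_square_norm)
      then show ?thesis using \<xi>[of c c] by (simp add: power2_eq_square)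
    qed
    then show ?thesis using that unfolding zonal_kernel_def Qpoly_def \<xi> by simp
  qed
  define z where "z = (\<lambda>c i. s i * poly (zonal (n + 2 * k) i) (e \<bullet> c))"
  define H where "H = (\<lambda>c c'. \<Sum>i<N. \<Sum>j<N. A $$ (i, j) * (z c i * z c' j))"
  have "(\<Sum>c\<in>C. \<Sum>c'\<in>C. H c c' * (r c * r c')) \<ge> 0" for r
  proof -
    have "(\<Sum>c\<in>C. \<Sum>c'\<in>C. H c c' * (r c * r c'))
        = (\<Sum>i<N. \<Sum>j<N. A $$ (i, j) * ((\<Sum>c\<in>C. r c * z c i) * (\<Sum>c'\<in>C. r c' * z c' j)))"
      unfolding H_def sum_product
      unfolding sum_distrib_right sum_distrib_left
      by (simp only: sum.swap[where A = "{..<N}" and B = C]) (simp only: mult_ac)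
    also have "\<dots> \<ge> 0" unfolding N_def by (rule pos_semidef_sum_nonneg[OF A])
    finally show ?thesis .
  qed
  then have "0 \<le> (\<Sum>c\<in>C. \<Sum>c'\<in>C. H c c' * zonal_kernel (n - 1) k (\<xi> c) (\<xi> c'))"
    using n by (intro sum_zonal_kernel_nonneg) (auto simp: n_def)
  then have "0 \<le> \<kappa> * (\<Sum>c\<in>C. \<Sum>c'\<in>C. H c c' * zonal_kernel (n - 1) k (\<xi> c) (\<xi> c'))"
    using \<kappa> by simp
  also have "\<dots> = (\<Sum>c\<in>C. \<Sum>c'\<in>C. mat_inner A (Ymat n d k (e \<bullet> c) (e \<bullet> c') (c \<bullet> c')))"
    unfolding sum_distrib_left
  proof (intro sum.cong refl)
    fix c c' assume c: "c \<in> C" "c' \<in> C"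
    have "mat_inner A (Ymat n d k (e \<bullet> c) (e \<bullet> c') (c \<bullet> c'))
       = (\<Sum>i<N. \<Sum>j<N. A $$ (i, j) * Ymat n d k (e \<bullet> c) (e \<bullet> c') (c \<bullet> c') $$ (i, j))"
      unfolding N_def by (rule mat_inner_eq_sum[OF A(2) Ymat_carrier])
    also have "\<dots> = (\<Sum>i<N. \<Sum>j<N. \<kappa> * (A $$ (i, j) * (z c i * z c' j)
         * Qpoly (n - 1) k (e \<bullet> c) (e \<bullet> c') (c \<bullet> c')))"
      by (intro sum.cong refl) (simp add: Ymat_def N_def lam z_def mult_ac)
    also have "\<dots> = \<kappa> * (H c c' * zonal_kernel (n - 1) k (\<xi> c) (\<xi> c'))"
      unfolding H_def sum_distrib_left sum_distrib_right Q[OF c] ..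
    finally show "\<kappa> * (H c c' * zonal_kernel (n - 1) k (\<xi> c) (\<xi> c'))
       = mat_inner A (Ymat n d k (e \<bullet> c) (e \<bullet> c') (c \<bullet> c'))" by simp
  qed
  finally show ?thesis by (simp add: n_def)
qed

lemma mat_inner_Ybar:
  assumes "A \<in> carrier_mat (d - k + 1) (d - k + 1)"
  shows "mat_inner A (Ybar n d k u v t)
     = (mat_inner A (Ymat n d k u v t) + mat_inner A (Ymat n d k v u t)) / 2"
proof -
  have "Ybar n d k u v t \<in> carrier_mat (d - k + 1) (d - k + 1)"
    by (simp add: Ybar_def Ymat_def)
  moreover have entry: "Ybar n d k u v t $$ (i, j) = (Ymat n d k u v t $$ (i, j) + Ymat n d k v u t $$ (i, j)) / 2"
    if "i < d - k + 1" "j < d - k + 1" for i j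
    using that by (simp add: Ybar_def Ymat_def)
  ultimately have "mat_inner A (Ybar n d k u v t) = (\<Sum>i<d - k + 1. \<Sum>j<d - k + 1.
      (A $$ (i, j) * Ymat n d k u v t $$ (i, j) + A $$ (i, j) * Ymat n d k v u t $$ (i, j)) / 2)"
    unfolding mat_inner_eq_sum[OF assms \<open>Ybar n d k u v t \<in> _\<close>]
    by (intro sum.cong refl) (simp only: lessThan_iff entry, simp add: distrib_left)
  then show ?thesis
    unfolding mat_inner_eq_sum[OF assms Ymat_carrier]
    by (simp only: sum_divide_distrib[symmetric] sum.distrib)
qed

lemma Ybar_commute: "Ybar n d k u v t = Ybar n d k v u t"
  unfolding Ybar_def using comm_add_mat[OF Ymat_carrier Ymat_carrier] by metis

text \<open>
  Symmetrizing in \<open>u\<close> and \<open>v\<close> amounts to exchanging the roles of \<open>c\<close> and \<open>c'\<close>, which does not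
  change the sum over all pairs.
\<close>

lemma sum_mat_inner_Ybar_nonneg:
  fixes e :: "real^'n" and C :: "(real^'n) set"
  assumes "CARD('n) \<ge> 3" "norm e = 1" "C \<subseteq> sphere 0 1"
    and A: "pos_semidef A" "A \<in> carrier_mat (d - k + 1) (d - k + 1)"
  shows "(\<Sum>c\<in>C. \<Sum>c'\<in>C. mat_inner A (Ybar CARD('n) d k (e \<bullet> c) (e \<bullet> c') (c \<bullet> c'))) \<ge> 0"
proof -
  define Y where "Y = (\<lambda>c c'. mat_inner A (Ymat CARD('n) d k (e \<bullet> c) (e \<bullet> c') (c \<bullet> c')))"
  have "(\<Sum>c\<in>C. \<Sum>c'\<in>C. mat_inner A (Ybar CARD('n) d k (e \<bullet> c) (e \<bullet> c') (c \<bullet> c')))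
      = ((\<Sum>c\<in>C. \<Sum>c'\<in>C. Y c c') + (\<Sum>c\<in>C. \<Sum>c'\<in>C. Y c' c)) / 2"
    by (simp add: mat_inner_Ybar[OF A(2)] Y_def inner_commute sum.distrib sum_divide_distrib add_divide_distrib)
  also have "(\<Sum>c\<in>C. \<Sum>c'\<in>C. Y c' c) = (\<Sum>c\<in>C. \<Sum>c'\<in>C. Y c c')"
    by (rule sum.swap)
  finally show ?thesis
    using sum_mat_inner_Ymat_nonneg[OF assms] by (simp add: Y_def)
qed


section \<open>Codes in a cap\<close>

text \<open>
  The Cauchy-Schwarz inequality for the projections of \<open>x\<close> and \<open>y\<close> to the orthogonal complement
  of \<open>e\<close>.
\<close>

lemma gram_determinant_nonneg:
  fixes e x y :: "'a::real_inner"
  assumes "norm e = 1" "norm x = 1" "norm y = 1"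
  shows "1 + 2 * (e \<bullet> x) * (e \<bullet> y) * (x \<bullet> y) - (e \<bullet> x)\<^sup>2 - (e \<bullet> y)\<^sup>2 - (x \<bullet> y)\<^sup>2 \<ge> 0"
proof -
  define u v t where "u = e \<bullet> x" and "v = e \<bullet> y" and "t = x \<bullet> y"
  have products: "e \<bullet> e = 1" "x \<bullet> x = 1" "y \<bullet> y = 1"
    "e \<bullet> x = u" "x \<bullet> e = u" "e \<bullet> y = v" "y \<bullet> e = v" "x \<bullet> y = t"
    using assms by (simp_all add: dot_square_norm u_def v_def t_def inner_commute)
  have "(x - u *\<^sub>R e) \<bullet> (y - v *\<^sub>R e) = t - u * v"
    "(x - u *\<^sub>R e) \<bullet> (x - u *\<^sub>R e) = 1 - u\<^sup>2" "(y - v *\<^sub>R e) \<bullet> (y - v *\<^sub>R e) = 1 - v\<^sup>2"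
    by (simp_all add: inner_diff_left inner_diff_right products power2_eq_square)
  then have "(t - u * v)\<^sup>2 \<le> (1 - u\<^sup>2) * (1 - v\<^sup>2)"
    using Cauchy_Schwarz_ineq[of "x - u *\<^sub>R e" "y - v *\<^sub>R e"] by simp
  then show ?thesis
    unfolding u_def[symmetric] v_def[symmetric] t_def[symmetric] by (simp add: power2_eq_square algebra_simps)
qed

lemma code_pair_in_Delta:
  fixes e :: "real^'n"
  assumes e: "norm e = 1" and C: "cap_code e \<theta> \<phi> C"
    and c: "c \<in> C" "c' \<in> C" "c \<noteq> c'" "e \<bullet> c \<le> e \<bullet> c'"
  shows "(e \<bullet> c, e \<bullet> c', c \<bullet> c') \<in> Delta \<theta> \<phi>"
proof -
  have norm: "norm c = 1" "norm c' = 1" and "cos \<phi> \<le> e \<bullet> c" "c \<bullet> c' \<le> cos \<theta>"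
    using C c by (auto simp: cap_code_def cap_def)
  moreover have "e \<bullet> c' \<le> 1" using norm_cauchy_schwarz[of e c'] e norm by simp
  moreover have "-1 \<le> c \<bullet> c'" using Cauchy_Schwarz_ineq2[of c c'] norm by simp
  ultimately show ?thesis
    using c(4) gram_determinant_nonneg[OF e norm] by (simp add: Delta_def)
qed

lemma code_point_in_Delta0:
  fixes e :: "real^'n"
  assumes e: "norm e = 1" and c: "c \<in> cap e \<phi>"
  shows "(e \<bullet> c, e \<bullet> c, c \<bullet> c) \<in> Delta0 \<phi>"
proof -
  have norm: "norm c = 1" and "cos \<phi> \<le> e \<bullet> c" using c by (simp_all add: cap_def)
  moreover have "e \<bullet> c \<le> 1" using norm_cauchy_schwarz[of e c] e norm by simp
  moreover have "c \<bullet> c = 1" using norm by (simp add: dot_square_norm)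
  ultimately show ?thesis unfolding Delta0_def by simp
qed

theorem theorem3p1:
  fixes e :: "real^'n" and \<theta> \<phi> M :: real and d :: nat and F :: "nat \<Rightarrow> real mat"
  assumes n: "CARD('n) \<ge> 3"
    and e: "e \<in> sphere 0 1"
    and \<theta>: "0 < \<theta>" "\<theta> \<le> pi"
    and \<phi>: "0 \<le> \<phi>" "\<phi> \<le> pi"
    and F: "\<And>k. k \<le> d \<Longrightarrow> F k \<in> carrier_mat (d - k + 1) (d - k + 1) \<and> symmetric_matrix (F k)"
    and i: "\<And>k. k \<le> d \<Longrightarrow> pos_semidef (F k)"
    and ii: "\<And>u v t. (u, v, t) \<in> Delta0 \<phi> \<Longrightarrow>
               (\<Sum>k\<le>d. mat_inner (F k) (Ybar CARD('n) d k u v t)) \<le> M"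
    and iii: "\<And>u v t. (u, v, t) \<in> Delta \<theta> \<phi> \<Longrightarrow>
               (\<Sum>k\<le>d. mat_inner (F k) (Ybar CARD('n) d k u v t)) \<le> -1"
  shows "real (max_code e \<theta> \<phi>) \<le> 1 + M"
proof -
  have e1: "norm e = 1" using e by simp
  have bound: "real (card C) \<le> 1 + M" if C: "cap_code e \<theta> \<phi> C" and "C \<noteq> {}" for C
  proof -
    have fin: "finite C" and cap: "C \<subseteq> cap e \<phi>" using C by (auto simp: cap_code_def)
    have sphere: "C \<subseteq> sphere 0 1" using cap by (auto simp: cap_def)
    define S where "S = (\<lambda>c c'. \<Sum>k\<le>d. mat_inner (F k) (Ybar CARD('n) d k (e \<bullet> c) (e \<bullet> c') (c \<bullet> c')))"
    have diag: "S c c \<le> M" if "c \<in> C" for c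
      using ii[OF code_point_in_Delta0[OF e1]] that cap by (auto simp: S_def)
    \<comment> \<open>\<open>\<Delta>\<close> contains only triples with \<open>u \<le> v\<close>; the other order follows by symmetry of \<open>S\<close>.\<close>
    have off: "S c c' \<le> -1" if c: "c \<in> C" "c' \<in> C" "c \<noteq> c'" for c c'
    proof (cases "e \<bullet> c \<le> e \<bullet> c'")
      case True
      then show ?thesis using iii[OF code_pair_in_Delta[OF e1 C c]] by (simp add: S_def)
    next
      case False
      then have "S c' c \<le> -1"
        using iii[OF code_pair_in_Delta[OF e1 C c(2,1)]] c(3) by (simp add: S_def)
      then show ?thesis
        by (simp add: S_def Ybar_commute[of _ _ _ "e \<bullet> c"] inner_commute[of c])
    qed
    have "0 \<le> (\<Sum>k\<le>d. \<Sum>c\<in>C. \<Sum>c'\<in>C. mat_inner (F k) (Ybar CARD('n) d k (e \<bullet> c) (e \<bullet> c') (c \<bullet> c')))"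
      using F i by (intro sum_nonneg sum_mat_inner_Ybar_nonneg[OF n e1 sphere]) auto
    also have "\<dots> = (\<Sum>c\<in>C. \<Sum>c'\<in>C. S c c')"
      unfolding S_def by (simp only: sum.swap[where A = "{..d}" and B = C])
    also have "\<dots> = (\<Sum>c\<in>C. S c c + (\<Sum>c'\<in>C - {c}. S c c'))"
      using fin by (intro sum.cong refl sum.remove)
    also have "\<dots> \<le> (\<Sum>c\<in>C. M + (\<Sum>c'\<in>C - {c}. -1))"
      by (intro sum_mono add_mono diag off) auto
    also have "\<dots> = real (card C) * (1 + M - real (card C))"
      using fin \<open>C \<noteq> {}\<close> by (simp add: of_nat_diff card_gt_0_iff Suc_leI algebra_simps)
    finally show ?thesis
      using fin \<open>C \<noteq> {}\<close> by (simp add: zero_le_mult_iff card_gt_0_iff)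
  qed
  have "max_code e \<theta> \<phi> \<in> {card C | C. cap_code e \<theta> \<phi> C}"
    unfolding max_code_def using finite_code_cards[OF \<theta>] by (intro Max_in)
  then obtain C where C: "cap_code e \<theta> \<phi> C" "max_code e \<theta> \<phi> = card C" by blast
  \<comment> \<open>For an empty code the counting argument gives nothing, and the claim is \<open>0 \<le> 1 + M\<close>;
    this follows from the code consisting of the centre alone.\<close>
  have "cap_code e \<theta> \<phi> {e}"
    using e1 by (simp add: cap_code_def cap_def dot_square_norm)
  then have "0 \<le> M" using bound[of "{e}"] by simp
  then show ?thesis using bound[of C] C by (cases "C = {}") auto
qed

end
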